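(* Let $D$ be a division ring and $n\in\mathbb{N}$. Then $\operatorname{diam}(M_n(D))=n-1$.
   Context: All rings are unital. For elements $a,b$ of a ring $R$, write $a\sim_1 b$ if there exist $c,d\in R$ with $a=cd$ and $b=dc$; inductively, $a\sim_{n+1}b$ if there exists $c\in R$ with $a\sim_1 c$ and $c\sim_n b$; $a\sim_0 b$ means $a=b$. Write $a\sim b$ if $a\sim_n b$ for some $n$. The commutative closure of $a$ is $C(a)=\overline{\{a\}}=\{x\in R\mid x\sim a\}$. For $x,y\in C(a)$ put $d(x,y)=\min\{n\ge 0\mid y\sim_n x\}$, and $\operatorname{diam}(C(a))=\sup\{d(x,y)\mid x,y\in C(a)\}\in\mathbb{N}\cup\{\infty\}$. The diameter of the ring $R$ is $\operatorname{diam}(R)=\sup\{\operatorname{diam}(C(a))\mid a\in R\}$.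
   Formalization: For n = 1 the division ring D is assumed commutative: if xy ≠ yx in D, then xy and yx are at distance 1 in M_1(D) = D, so diam(M_1(D)) is not 0; the natural number n is taken to be at least 1. *)

theory Defs
  imports "Jordan_Normal_Form.Matrix" "HOL-Library.Extended_Nat"
begin

definition sim1 :: "('a, 'm) ring_scheme \<Rightarrow> 'a \<Rightarrow> 'a \<Rightarrow> bool" where
  "sim1 R a b \<longleftrightarrow>
    (\<exists>c\<in>carrier R. \<exists>d\<in>carrier R. a = c \<otimes>\<^bsub>R\<^esub> d \<and> b = d \<otimes>\<^bsub>R\<^esub> c)"

primrec sim_n :: "('a, 'm) ring_scheme \<Rightarrow> nat \<Rightarrow> 'a \<Rightarrow> 'a \<Rightarrow> bool" where
  "sim_n R 0 a b \<longleftrightarrow> a = b"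
| "sim_n R (Suc n) a b \<longleftrightarrow> (\<exists>c\<in>carrier R. sim1 R a c \<and> sim_n R n c b)"

definition sim :: "('a, 'm) ring_scheme \<Rightarrow> 'a \<Rightarrow> 'a \<Rightarrow> bool" where
  "sim R a b \<longleftrightarrow> (\<exists>n. sim_n R n a b)"

definition comm_closure :: "('a, 'm) ring_scheme \<Rightarrow> 'a \<Rightarrow> 'a set" where
  "comm_closure R a = {x \<in> carrier R. sim R x a}"

text \<open>
  The distance is meant for two elements of the same commutative closure; they are always
  related by some \<open>sim_n\<close> (see \<open>comm_closure_imp_sim\<close> below), so the minimum exists.
\<close>

definition comm_dist :: "('a, 'm) ring_scheme \<Rightarrow> 'a \<Rightarrow> 'a \<Rightarrow> nat" where
  "comm_dist R x y = (LEAST n. sim_n R n y x)"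

definition closure_diam :: "('a, 'm) ring_scheme \<Rightarrow> 'a \<Rightarrow> enat" where
  "closure_diam R a =
    (SUP (x, y) \<in> comm_closure R a \<times> comm_closure R a. enat (comm_dist R x y))"

definition ring_diam :: "('a, 'm) ring_scheme \<Rightarrow> enat" where
  "ring_diam R = (SUP a \<in> carrier R. closure_diam R a)"

lemma sim1_sym: "sim1 R a b \<Longrightarrow> sim1 R b a"
  unfolding sim1_def by blast

lemma sim_n_trans: "sim_n R m a b \<Longrightarrow> sim_n R n b c \<Longrightarrow> sim_n R (m + n) a c"
  by (induction m arbitrary: a) auto

lemma sim_n_sym:
  assumes "a \<in> carrier R" and "sim_n R n a b"
  shows "sim_n R n b a"
  using assms
proof (induction n arbitrary: a)
  case (Suc n)
  then obtain c where c: "c \<in> carrier R" "sim1 R a c" "sim_n R n c b" by auto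
  have "sim_n R 1 c a" using Suc.prems(1) sim1_sym[OF c(2)] by auto
  then show ?case using sim_n_trans[OF Suc.IH[OF c(1,3)]] by fastforce
qed simp

lemma comm_closure_imp_sim:
  assumes "x \<in> comm_closure R a" and "y \<in> comm_closure R a"
  shows "sim R y x"
  using assms unfolding comm_closure_def sim_def by (blast intro: sim_n_sym sim_n_trans)

text \<open>
  For a noncommutative division ring \<open>D\<close>, distinct conjugates \<open>x * y\<close> and \<open>y * x\<close> give two
  elements of \<open>M\<^sub>1(D)\<close> at positive distance.  So the formula \<open>diam(M\<^sub>n(D)) = n - 1\<close> fails
  for \<open>n = 1\<close> unless \<open>D\<close> is commutative.
\<close>

lemma ring_diam_mat_1_noncomm:
  fixes x y :: "'d :: division_ring"
  assumes "x * y \<noteq> y * x"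
  shows "ring_diam (ring_mat TYPE('d) 1 ()) \<noteq> 0"
proof
  let ?R = "ring_mat TYPE('d) 1 ()"
  let ?X = "mat 1 1 (\<lambda>_. x)" and ?Y = "mat 1 1 (\<lambda>_. y)"
  assume zero: "ring_diam ?R = 0"
  have prod: "?X * ?Y = mat 1 1 (\<lambda>_. x * y)" "?Y * ?X = mat 1 1 (\<lambda>_. y * x)"
    by (auto simp: scalar_prod_def)
  have ne: "?X * ?Y \<noteq> ?Y * ?X"
  proof
    assume "?X * ?Y = ?Y * ?X"
    then have "(?X * ?Y) $$ (0, 0) = (?Y * ?X) $$ (0, 0)" by simp
    with assms show False unfolding prod by simp
  qed
  have carr: "?X * ?Y \<in> carrier ?R" "?Y * ?X \<in> carrier ?R"
    by (auto simp: ring_mat_simps)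
  have "sim1 ?R (?Y * ?X) (?X * ?Y)"
    unfolding sim1_def by (rule bexI[of _ ?Y], rule bexI[of _ ?X]) (auto simp: ring_mat_simps)
  then have s: "sim_n ?R 1 (?Y * ?X) (?X * ?Y)" using carr by auto
  have mem: "?X * ?Y \<in> comm_closure ?R (?X * ?Y)" "?Y * ?X \<in> comm_closure ?R (?X * ?Y)"
    using carr s sim_n.simps(1)[of ?R "?X * ?Y" "?X * ?Y"]
    unfolding comm_closure_def sim_def by blast+
  have "enat (comm_dist ?R (?X * ?Y) (?Y * ?X)) \<le> closure_diam ?R (?X * ?Y)"
    unfolding closure_diam_def
    by (rule SUP_upper2[of "(?X * ?Y, ?Y * ?X)"]) (use mem in auto)
  also have "\<dots> \<le> ring_diam ?R"
    unfolding ring_diam_def by (rule SUP_upper) (rule carr)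
  finally have "comm_dist ?R (?X * ?Y) (?Y * ?X) = 0"
    using zero by (simp add: zero_enat_def)
  with LeastI[of "\<lambda>n. sim_n ?R n (?Y * ?X) (?X * ?Y)", OF s]
  have "?Y * ?X = ?X * ?Y" unfolding comm_dist_def by simp
  with ne show False by simp
qed

end

theory Submission
  imports Defs
begin

text \<open>
  Allow rectangular factors in \<open>a = c d\<close>, \<open>b = d c\<close>. Over a division ring a singular matrix of size \<open>n\<close>
  is then equivalent to one of size \<open>n - 1\<close>, so every matrix shrinks, one row at a time, to an invertible core,
  and shift equivalence shows that this core is determined up to similarity by the class of the matrix.

  Upper bound: let \<open>a \<sim> b\<close>. If \<open>a\<close> shrinks in \<open>r\<close> steps to a matrix \<open>c\<close> and \<open>b\<close> is similar to \<open>c \<oplus> d\<close>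
  with \<open>d\<close> nilpotent of size \<open>r\<close>, then \<open>a\<close> and \<open>b\<close> are joined by \<open>r\<close> steps of fixed size \<open>n\<close>: shrink
  \<open>a\<close> towards \<open>c\<close> and simultaneously let \<open>d\<close> grow from the empty matrix. If the core is nonempty, take for
  \<open>c\<close> the core of \<open>b\<close> (Fitting). If \<open>a\<close> and \<open>b\<close> are nilpotent, say with the index of \<open>b\<close> at most that
  of \<open>a\<close>, take for \<open>c\<close> a largest Jordan block of \<open>b\<close>. In both cases \<open>r \<le> n - 1\<close>.

  Lower bound: a chain of \<open>k\<close> steps from \<open>0\<close> to the nilpotent Jordan block \<open>s\<close> of size \<open>n\<close> forces
  \<open>s\<^sup>k\<^sup>+\<^sup>1 = 0\<close>.
\<close>

section \<open>Linear algebra over a division ring\<close>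

lemma assoc_mult_mat_dim:
  "dim_col A = dim_row B \<Longrightarrow> dim_col B = dim_row C \<Longrightarrow> (A * B) * C = A * (B * (C :: 'a :: semiring_0 mat))"
  by (rule assoc_mult_mat[of _ "dim_row A" "dim_row B" _ "dim_row C" _ "dim_col C"]) auto

lemma index_mult_mat_sum:
  assumes "A \<in> carrier_mat n k" "B \<in> carrier_mat k m" "i < n" "j < m"
  shows "(A * B) $$ (i, j) = (\<Sum>l<k. A $$ (i, l) * B $$ (l, j))"
  using assms by (auto simp: scalar_prod_def atLeast0LessThan)

lemma invertible_matI:
  assumes "A \<in> carrier_mat n n" "B \<in> carrier_mat n n" "A * B = 1\<^sub>m n" "B * A = 1\<^sub>m n"
  shows "invertible_mat A"
  using assms unfolding invertible_mat_def inverts_mat_def by auto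

lemma invertible_matE:
  assumes "invertible_mat A" "A \<in> carrier_mat n n"
  obtains B where "B \<in> carrier_mat n n" "A * B = 1\<^sub>m n" "B * A = 1\<^sub>m n"
proof -
  from assms obtain B where B: "A * B = 1\<^sub>m n" "B * A = 1\<^sub>m (dim_row B)"
    unfolding invertible_mat_def inverts_mat_def by auto
  from arg_cong[OF B(1), of dim_col] arg_cong[OF B(2), of dim_col] assms(2)
  have "B \<in> carrier_mat n n" by auto
  with B that show thesis by auto
qed

text \<open>Gaussian elimination with coefficients kept on the left: a pivot in the last column
  clears the other rows, and the induction continues without the pivot row. Arbitrary finite index
  sets allow that row to be removed wherever it lies.\<close>

lemma exists_left_null_coeffs:
  fixes A :: "'i \<Rightarrow> nat \<Rightarrow> 'd :: division_ring"
  assumes "finite I" "m < card I"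
  shows "\<exists>x. (\<exists>i\<in>I. x i \<noteq> 0) \<and> (\<forall>j<m. (\<Sum>i\<in>I. x i * A i j) = 0)"
  using assms
proof (induction m arbitrary: I A)
  case 0
  then obtain i where "i \<in> I" by fastforce
  then show ?case by (intro exI[of _ "\<lambda>_. 1"]) auto
next
  case (Suc m)
  show ?case
  proof (cases "\<forall>i\<in>I. A i m = 0")
    case True
    from Suc.IH[of I A] Suc.prems obtain x where
      "\<exists>i\<in>I. x i \<noteq> 0" "\<forall>j<m. (\<Sum>i\<in>I. x i * A i j) = 0" by auto
    with True show ?thesis by (intro exI[of _ x]) (auto simp: less_Suc_eq)
  next
    case False
    then obtain p where p: "p \<in> I" "A p m \<noteq> 0" by auto
    let ?I = "I - {p}" and ?c = "\<lambda>i. A i m * inverse (A p m)"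
    have "m < card ?I" using Suc.prems p by auto
    from Suc.IH[OF _ this, of "\<lambda>i j. A i j - ?c i * A p j"] Suc.prems obtain x where
      x: "\<exists>i\<in>?I. x i \<noteq> 0" "\<forall>j<m. (\<Sum>i\<in>?I. x i * (A i j - ?c i * A p j)) = 0" by auto
    \<comment> \<open>The pivot row receives the multiples that the elimination subtracted, so that
      \<open>y\<close> applied to the original rows equals \<open>x\<close> applied to the reduced
      ones.\<close>
    define y where "y = x(p := - (\<Sum>i\<in>?I. x i * ?c i))"
    have sum: "(\<Sum>i\<in>I. y i * A i j) = (\<Sum>i\<in>?I. x i * (A i j - ?c i * A p j))" for j
    proof -
      have "(\<Sum>i\<in>I. y i * A i j) = y p * A p j + (\<Sum>i\<in>?I. y i * A i j)"
        using Suc.prems p by (simp add: sum.remove)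
      also have "(\<Sum>i\<in>?I. y i * A i j) = (\<Sum>i\<in>?I. x i * A i j)"
        by (rule sum.cong) (auto simp: y_def)
      finally show ?thesis
        by (simp add: y_def sum_subtractf sum_distrib_right right_diff_distrib mult.assoc)
    qed
    have "(\<Sum>i\<in>I. y i * A i j) = 0" if "j < Suc m" for j
      using that x p by (cases "j = m") (auto simp: sum mult.assoc)
    moreover have "\<exists>i\<in>I. y i \<noteq> 0" using x(1) by (auto simp: y_def)
    ultimately show ?thesis by blast
  qed
qed

lemma exists_left_null_vector:
  fixes A :: "'d :: division_ring mat"
  assumes "A \<in> carrier_mat n m" "m < n"
  obtains x where "x \<in> carrier_mat 1 n" "x \<noteq> 0\<^sub>m 1 n" "x * A = 0\<^sub>m 1 m"
proof -
  from exists_left_null_coeffs[of "{..<n}" m "\<lambda>i j. A $$ (i, j)"] assms obtain x where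
    x: "\<exists>i\<in>{..<n}. x i \<noteq> 0" "\<forall>j<m. (\<Sum>i<n. x i * A $$ (i, j)) = 0" by auto
  let ?x = "mat 1 n (\<lambda>(_, i). x i)"
  have "?x * A = 0\<^sub>m 1 m"
    using x(2) assms by (intro eq_matI) (auto simp: index_mult_mat_sum[of _ 1 n] simp del: index_mult_mat(1))
  moreover from x(1) obtain i where "i < n" "x i \<noteq> 0" by auto
  then have "?x $$ (0, i) \<noteq> 0\<^sub>m 1 n $$ (0, i)" by auto
  then have "?x \<noteq> 0\<^sub>m 1 n" by metis
  ultimately show thesis using that[of ?x] by auto
qed

lemma left_inverse_or_left_null:
  fixes A :: "'d :: division_ring mat"
  assumes A: "A \<in> carrier_mat n n" and nn: "\<And>x. x \<in> carrier_mat 1 n \<Longrightarrow> x * A = 0\<^sub>m 1 n \<Longrightarrow> x = 0\<^sub>m 1 n"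
  obtains B where "B \<in> carrier_mat n n" "B * A = 1\<^sub>m n"
proof -
  have "\<exists>b. \<forall>j<n. (\<Sum>i<n. b i * A $$ (i, j)) = (if k = j then 1 else 0)" for k
  proof -
    \<comment> \<open>Row \<open>k\<close> of the left inverse: append the \<open>k\<close>-th unit
      row to \<open>A\<close>. The resulting \<open>n + 1\<close> rows of length \<open>n\<close>
      are left dependent, and the coefficient of the extra row is nonzero since \<open>A\<close> has
      trivial left kernel; dividing by it solves for the unit row.\<close>
    let ?A = "\<lambda>i j. if i < n then A $$ (i, j) else if k = j then 1 else 0"
    from exists_left_null_coeffs[of "{..<Suc n}" n ?A] obtain x where
      x: "\<exists>i<Suc n. x i \<noteq> 0" "\<forall>j<n. (\<Sum>i<Suc n. x i * ?A i j) = 0" by auto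
    then have s: "(\<Sum>i<n. x i * A $$ (i, j)) + x n * (if k = j then 1 else 0) = 0" if "j < n" for j
      using that by simp
    have "x n \<noteq> 0"
    proof
      assume xn: "x n = 0"
      have s': "(\<Sum>i<n. x i * A $$ (i, j)) = 0" if "j < n" for j using s[OF that] xn by simp
      let ?x = "mat 1 n (\<lambda>(_, i). x i)"
      have "?x * A = 0\<^sub>m 1 n"
        using s' A by (intro eq_matI) (auto simp: index_mult_mat_sum[of _ 1 n] simp del: index_mult_mat(1))
      then have z: "?x = 0\<^sub>m 1 n" by (rule nn[rotated]) simp
      have "x i = 0" if "i < n" for i
        using arg_cong[OF z, of "\<lambda>M. M $$ (0, i)"] that by simp
      with x(1) xn show False by (auto simp: less_Suc_eq)
    qed
    have "(\<Sum>i<n. (- inverse (x n) * x i) * A $$ (i, j)) = (if k = j then 1 else 0)" if "j < n" for j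
    proof -
      have "(\<Sum>i<n. (- inverse (x n) * x i) * A $$ (i, j)) = - inverse (x n) * (\<Sum>i<n. x i * A $$ (i, j))"
        by (simp add: sum_distrib_left mult.assoc sum_negf)
      also have "(\<Sum>i<n. x i * A $$ (i, j)) = - (x n * (if k = j then 1 else 0))"
        using s[OF that] by (simp add: eq_neg_iff_add_eq_0)
      finally show ?thesis using \<open>x n \<noteq> 0\<close> by auto
    qed
    then show ?thesis by (intro exI[of _ "\<lambda>i. - inverse (x n) * x i"]) auto
  qed
  then obtain b where b: "\<And>k j. j < n \<Longrightarrow> (\<Sum>i<n. b k i * A $$ (i, j)) = (if k = j then 1 else 0)" by metis
  show thesis
    by (rule that[of "mat n n (\<lambda>(k, i). b k i)"])
      (use A b in \<open>auto intro!: eq_matI simp: index_mult_mat_sum[of _ n n] simp del: index_mult_mat(1)\<close>)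
qed

text \<open>A left inverse \<open>B\<close> has trivial left kernel too, because
  \<open>B * A\<close> is the identity. Hence \<open>B\<close> has a left inverse \<open>C\<close>,
  and associativity forces \<open>C = A\<close>.\<close>

lemma invertible_if_no_left_null:
  fixes A :: "'d :: division_ring mat"
  assumes A: "A \<in> carrier_mat n n" and nn: "\<And>x. x \<in> carrier_mat 1 n \<Longrightarrow> x * A = 0\<^sub>m 1 n \<Longrightarrow> x = 0\<^sub>m 1 n"
  shows "invertible_mat A"
proof -
  from left_inverse_or_left_null[OF assms] obtain B where B: "B \<in> carrier_mat n n" "B * A = 1\<^sub>m n" by auto
  have "x = 0\<^sub>m 1 n" if x: "x \<in> carrier_mat 1 n" "x * B = 0\<^sub>m 1 n" for x
  proof -
    have "x = (x * B) * A" using x(1) A B by (simp add: assoc_mult_mat_dim)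
    then show ?thesis using x A by simp
  qed
  from left_inverse_or_left_null[OF B(1) this] obtain C where C: "C \<in> carrier_mat n n" "C * B = 1\<^sub>m n" by auto
  have "C = C * (B * A)" using B C by simp
  also have "\<dots> = (C * B) * A" using A B(1) C(1) by (simp add: assoc_mult_mat_dim)
  also have "\<dots> = A" using A C by simp
  finally have "C = A" .
  with A B C show ?thesis by (intro invertible_matI[of _ n B]) auto
qed

text \<open>A left null vector of \<open>Q\<close> would also be annihilated by the identity
  \<open>Q * P\<close>. This bound takes the place of a rank function.\<close>

lemma dim_le_of_mult_eq_one:
  fixes P :: "'d :: division_ring mat"
  assumes "Q \<in> carrier_mat p n" "P \<in> carrier_mat n p" "Q * P = 1\<^sub>m p"
  shows "p \<le> n"
proof (rule ccontr)
  assume "\<not> p \<le> n"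
  with exists_left_null_vector[OF assms(1)] obtain x where
    x: "x \<in> carrier_mat 1 p" "x \<noteq> 0\<^sub>m 1 p" "x * Q = 0\<^sub>m 1 n" by auto
  have "x = (x * Q) * P" using x(1) assms by (simp add: assoc_mult_mat_dim)
  then show False using x assms(2) by simp
qed

section \<open>Block matrices and split idempotents\<close>

definition hcat :: "'a :: zero mat \<Rightarrow> 'a mat \<Rightarrow> 'a mat" where
  "hcat A B = four_block_mat A B (0\<^sub>m 0 (dim_col A)) (0\<^sub>m 0 (dim_col B))"

definition vcat :: "'a :: zero mat \<Rightarrow> 'a mat \<Rightarrow> 'a mat" where
  "vcat A B = four_block_mat A (0\<^sub>m (dim_row A) 0) B (0\<^sub>m (dim_row B) 0)"

lemma hcat_carrier[simp]:
  "A \<in> carrier_mat n p \<Longrightarrow> B \<in> carrier_mat n q \<Longrightarrow> hcat A B \<in> carrier_mat n (p + q)"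
  unfolding hcat_def by auto

lemma vcat_carrier[simp]:
  "A \<in> carrier_mat p n \<Longrightarrow> B \<in> carrier_mat q n \<Longrightarrow> vcat A B \<in> carrier_mat (p + q) n"
  unfolding vcat_def by auto

lemma vcat_mult_hcat:
  fixes A :: "'a :: semiring_0 mat"
  assumes "A \<in> carrier_mat p n" "B \<in> carrier_mat q n" "C \<in> carrier_mat n r" "D \<in> carrier_mat n s"
  shows "vcat A B * hcat C D = four_block_mat (A * C) (A * D) (B * C) (B * D)"
proof -
  have "vcat A B * hcat C D = four_block_mat (A * C + 0\<^sub>m p 0 * 0\<^sub>m 0 r) (A * D + 0\<^sub>m p 0 * 0\<^sub>m 0 s)
      (B * C + 0\<^sub>m q 0 * 0\<^sub>m 0 r) (B * D + 0\<^sub>m q 0 * 0\<^sub>m 0 s)"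
    unfolding vcat_def hcat_def using assms by (subst mult_four_block_mat) auto
  then show ?thesis using assms by simp
qed

lemma hcat_mult_vcat:
  fixes A :: "'a :: semiring_0 mat"
  assumes "A \<in> carrier_mat n p" "B \<in> carrier_mat n q" "C \<in> carrier_mat p m" "D \<in> carrier_mat q m"
  shows "hcat A B * vcat C D = A * C + B * D"
proof -
  have "hcat A B * vcat C D = four_block_mat (A * C + B * D) (0\<^sub>m n 0) (0\<^sub>m 0 m) (0\<^sub>m 0 0)"
    unfolding vcat_def hcat_def using assms by (subst mult_four_block_mat) auto
  also have "\<dots> = A * C + B * D" using assms by (intro eq_matI) auto
  finally show ?thesis .
qed

lemma mult_hcat:
  fixes A :: "'a :: semiring_0 mat"
  assumes "A \<in> carrier_mat m n" "C \<in> carrier_mat n r" "D \<in> carrier_mat n s"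
  shows "A * hcat C D = hcat (A * C) (A * D)"
proof -
  \<comment> \<open>Padding with empty blocks turns the product into a block product.\<close>
  have A: "A = four_block_mat A (0\<^sub>m m 0) (0\<^sub>m 0 n) (0\<^sub>m 0 0)" using assms by (intro eq_matI) auto
  show ?thesis
    by (subst A, unfold hcat_def, subst mult_four_block_mat) (use assms in auto)
qed

lemma vcat_mult:
  fixes A :: "'a :: semiring_0 mat"
  assumes "A \<in> carrier_mat m n" "C \<in> carrier_mat r m" "D \<in> carrier_mat s m"
  shows "vcat C D * A = vcat (C * A) (D * A)"
proof -
  have A: "A = four_block_mat A (0\<^sub>m m 0) (0\<^sub>m 0 n) (0\<^sub>m 0 0)" using assms by (intro eq_matI) auto
  show ?thesis
    by (subst A, unfold vcat_def, subst mult_four_block_mat) (use assms in auto)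
qed

lemma minus_zero_mat: "A \<in> carrier_mat n m \<Longrightarrow> A - 0\<^sub>m n m = (A :: 'a :: group_add mat)"
  by (intro eq_matI) auto

text \<open>Choose \<open>k\<close> maximal among the retracts \<open>P\<close>, \<open>Q\<close>
  that live inside \<open>E\<close>. The remainder \<open>F = E - P * Q\<close> is an idempotent
  orthogonal to them; a nonzero entry of \<open>F\<close> would allow one more column and
  row.\<close>

lemma idempotent_factorization:
  fixes E :: "'d :: division_ring mat"
  assumes E: "E \<in> carrier_mat n n" "E * E = E"
  obtains k P Q where "P \<in> carrier_mat n k" "Q \<in> carrier_mat k n" "Q * P = 1\<^sub>m k" "P * Q = E"
proof -
  define K where "K k \<longleftrightarrow> (\<exists>P Q. P \<in> carrier_mat n k \<and> Q \<in> carrier_mat k n \<and> Q * P = 1\<^sub>m k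
    \<and> E * P = P \<and> Q * E = Q)" for k
  have K0: "K 0" unfolding K_def
    by (intro exI[of _ "0\<^sub>m n 0"] exI[of _ "0\<^sub>m 0 n"]) (use E in auto)
  have bound: "K k \<Longrightarrow> k \<le> n" for k unfolding K_def using dim_le_of_mult_eq_one by blast
  define k where "k = Greatest K"
  have "K k" unfolding k_def using GreatestI_nat[of K 0 n] K0 bound by blast
  then obtain P Q where P: "P \<in> carrier_mat n k" "E * P = P" and Q: "Q \<in> carrier_mat k n" "Q * E = Q"
    and QP: "Q * P = 1\<^sub>m k" unfolding K_def by blast
  define F where "F = E - P * Q"
  have F: "F \<in> carrier_mat n n" unfolding F_def using P Q by auto
  have EF: "E * F = F" unfolding F_def
    using E P Q by (simp add: mult_minus_distrib_mat[of _ n n _ n] assoc_mult_mat_dim[symmetric])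
  have FE: "F * E = F" unfolding F_def
    using E P Q by (simp add: minus_mult_distrib_mat[of _ n n _ _ n] assoc_mult_mat_dim)
  have QF: "Q * F = 0\<^sub>m k n" unfolding F_def
    using E P Q QP by (simp add: mult_minus_distrib_mat[of _ k n _ n] assoc_mult_mat_dim[symmetric])
  have FP: "F * P = 0\<^sub>m n k" unfolding F_def
    using E P Q QP by (simp add: minus_mult_distrib_mat[of _ n n _ _ k] assoc_mult_mat_dim)
  have FF: "F * F = F"
  proof -
    have "F * F = F * E - (F * P) * Q"
      using F P Q E by (subst (2) F_def) (simp add: mult_minus_distrib_mat[of _ n n _ n] assoc_mult_mat_dim)
    also have "\<dots> = F" using FE FP Q F by (simp add: minus_zero_mat)
    finally show ?thesis .
  qed
  have "F = 0\<^sub>m n n"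
  proof (rule ccontr)
    assume "F \<noteq> 0\<^sub>m n n"
    then obtain i j where ij: "i < n" "j < n" "F $$ (i, j) \<noteq> 0" using F by (metis eq_matI index_zero_mat carrier_matD)
    let ?t = "F $$ (i, j)"
    \<comment> \<open>Row \<open>i\<close> and column \<open>j\<close> of \<open>F\<close>, scaled
      so that \<open>z * y\<close> is the entry of \<open>inverse ?t * (F * F)\<close> at that
      place, which is 1 because \<open>F\<close> is idempotent.\<close>
    define z where "z = mat 1 n (\<lambda>(_, l). inverse ?t * F $$ (i, l))"
    define y where "y = mat n 1 (\<lambda>(l, _). F $$ (l, j))"
    have z: "z \<in> carrier_mat 1 n" and y: "y \<in> carrier_mat n 1" unfolding z_def y_def by auto
    have zi: "z $$ (0, l) = inverse ?t * F $$ (i, l)" if "l < n" for l using that by (simp add: z_def)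
    have yi: "y $$ (l, 0) = F $$ (l, j)" if "l < n" for l using that by (simp add: y_def)
    have zM: "(z * M) $$ (0, l) = inverse ?t * (F * M) $$ (i, l)" if "M \<in> carrier_mat n m" "l < m" for M m l
      using that ij
      by (simp add: index_mult_mat_sum[OF z that(1)] index_mult_mat_sum[OF F that(1)] zi
        sum_distrib_left mult.assoc del: index_mult_mat(1))
    have My: "(M * y) $$ (l, 0) = (M * F) $$ (l, j)" if "M \<in> carrier_mat m n" "l < m" for M m l
      using that ij
      by (simp add: index_mult_mat_sum[OF that(1) y] index_mult_mat_sum[OF that(1) F] yi del: index_mult_mat(1))
    have zE: "z * E = z" using z E ij by (intro eq_matI) (auto simp: zM[OF E(1)] FE zi simp del: index_mult_mat(1))
    have zP: "z * P = 0\<^sub>m 1 k" using z P ij by (intro eq_matI) (auto simp: zM[OF P(1)] FP simp del: index_mult_mat(1))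
    have Ey: "E * y = y" using y E ij by (intro eq_matI) (auto simp: My[OF E(1)] EF yi simp del: index_mult_mat(1))
    have Qy: "Q * y = 0\<^sub>m k 1" using y Q ij by (intro eq_matI) (auto simp: My[OF Q(1)] QF simp del: index_mult_mat(1))
    have "(F * y) $$ (i, 0) = ?t" using ij by (simp add: My[OF F] FF del: index_mult_mat(1))
    then have zy: "z * y = 1\<^sub>m 1" using y z ij by (intro eq_matI) (auto simp: zM[OF y] simp del: index_mult_mat(1))
    have "K (k + 1)" unfolding K_def
    proof (intro exI conjI)
      show "hcat P y \<in> carrier_mat n (k + 1)" "vcat Q z \<in> carrier_mat (k + 1) n"
        using hcat_carrier[OF P(1) y] vcat_carrier[OF Q(1) z] by simp_all
      show "vcat Q z * hcat P y = 1\<^sub>m (k + 1)"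
        using vcat_mult_hcat[OF Q(1) z P(1) y] by (simp add: QP Qy zP zy)
      show "E * hcat P y = hcat P y" using mult_hcat[OF E(1) P(1) y] P Ey by simp
      show "vcat Q z * E = vcat Q z" using vcat_mult[OF E(1) Q(1) z] Q zE by simp
    qed
    then have "k + 1 \<le> k" unfolding k_def using Greatest_le_nat[of K _ n] bound by blast
    then show False by simp
  qed
  have "P * Q = E"
  proof (rule eq_matI)
    fix i j assume "i < dim_row E" "j < dim_col E"
    then show "(P * Q) $$ (i, j) = E $$ (i, j)"
      using arg_cong[OF \<open>F = 0\<^sub>m n n\<close>, of "\<lambda>M. M $$ (i, j)"] E P Q by (simp add: F_def del: index_mult_mat(1))
  qed (use E P Q in auto)
  with that P Q QP show thesis by blast
qed

section \<open>Direct sums and invariant complements\<close>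

definition dsum :: "'a :: zero mat \<Rightarrow> 'a mat \<Rightarrow> 'a mat" where
  "dsum A B = four_block_mat A (0\<^sub>m (dim_row A) (dim_col B)) (0\<^sub>m (dim_row B) (dim_col A)) B"

lemma dim_dsum[simp]:
  "dim_row (dsum A B) = dim_row A + dim_row B" "dim_col (dsum A B) = dim_col A + dim_col B"
  unfolding dsum_def by auto

lemma dsum_carrier[simp]:
  "A \<in> carrier_mat n m \<Longrightarrow> B \<in> carrier_mat k l \<Longrightarrow> dsum A B \<in> carrier_mat (n + k) (m + l)"
  unfolding dsum_def by auto

lemma dsum_mult:
  fixes A :: "'a :: semiring_0 mat"
  assumes "dim_col A = dim_row C" "dim_col B = dim_row D"
  shows "dsum A B * dsum C D = dsum (A * C) (B * D)"
  unfolding dsum_def using assms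
  by (subst mult_four_block_mat[of _ "dim_row A" "dim_row C" _ "dim_row D" _ "dim_row B" _ _ "dim_col C" _ "dim_col D"]) auto

lemma dsum_one: "dsum (1\<^sub>m n) (1\<^sub>m m) = (1\<^sub>m (n + m) :: 'a :: semiring_1 mat)"
  unfolding dsum_def by simp

lemma dsum_empty[simp]: "B \<in> carrier_mat 0 0 \<Longrightarrow> dsum A B = A" "B \<in> carrier_mat 0 0 \<Longrightarrow> dsum B A = A"
  unfolding dsum_def by (auto intro!: eq_matI)

lemma similar_dsum:
  assumes "similar_mat A B" "similar_mat C D"
  shows "similar_mat (dsum A C) (dsum B D)"
proof -
  from similar_matD[OF assms(1)] obtain n where "A \<in> carrier_mat n n" "B \<in> carrier_mat n n" by blast
  moreover from similar_matD[OF assms(2)] obtain m where "C \<in> carrier_mat m m" "D \<in> carrier_mat m m" by blast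
  ultimately show ?thesis unfolding dsum_def using similar_mat_four_block_0_0[OF assms, of n m] by simp
qed

text \<open>The complement comes from splitting the idempotent \<open>1 - P * Q\<close>. The sizes
  add up because the combined matrices are inverse to each other on both sides.\<close>

lemma retract_complement:
  fixes P :: "'d :: division_ring mat"
  assumes P: "P \<in> carrier_mat n p" and Q: "Q \<in> carrier_mat p n" and QP: "Q * P = 1\<^sub>m p"
  obtains k P' Q' where "p + k = n" "P' \<in> carrier_mat n k" "Q' \<in> carrier_mat k n" "Q' * P' = 1\<^sub>m k"
    "Q * P' = 0\<^sub>m p k" "Q' * P = 0\<^sub>m k p" "P * Q + P' * Q' = 1\<^sub>m n"
proof -
  define E where "E = 1\<^sub>m n - P * Q"
  have E: "E \<in> carrier_mat n n" unfolding E_def using P Q by auto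
  have EP: "E * P = 0\<^sub>m n p" unfolding E_def
    using P Q QP by (simp add: minus_mult_distrib_mat[of _ n n _ _ p] assoc_mult_mat_dim)
  have QE: "Q * E = 0\<^sub>m p n" unfolding E_def
    using P Q QP by (simp add: mult_minus_distrib_mat[of _ p n _ n] assoc_mult_mat_dim[symmetric])
  have EE: "E * E = E"
  proof -
    have "E * E = E * 1\<^sub>m n - E * P * Q" using E P Q
      by (subst (2) E_def) (simp add: mult_minus_distrib_mat[of _ n n _ n] assoc_mult_mat_dim)
    also have "\<dots> = E" using EP Q E by (simp add: minus_zero_mat)
    finally show ?thesis .
  qed
  from idempotent_factorization[OF E EE] obtain k P' Q' where
    P': "P' \<in> carrier_mat n k" and Q': "Q' \<in> carrier_mat k n" and
    QP': "Q' * P' = 1\<^sub>m k" and PQ': "P' * Q' = E" .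
  \<comment> \<open>Inserting the identity \<open>Q' * P'\<close> exposes
    \<open>P' * Q' = E\<close>, which \<open>Q\<close> annihilates.\<close>
  have "Q * P' = (Q * P') * (Q' * P')" using QP' P' Q by simp
  also have "\<dots> = Q * (P' * Q') * P'" using Q P' Q' by (simp add: assoc_mult_mat_dim)
  also have "\<dots> = 0\<^sub>m p k" using PQ' QE P' by simp
  finally have QP0: "Q * P' = 0\<^sub>m p k" .
  have "Q' * P = (Q' * P') * (Q' * P)" using QP' P Q' by simp
  also have "\<dots> = Q' * ((P' * Q') * P)" using P P' Q' by (simp add: assoc_mult_mat_dim)
  also have "\<dots> = 0\<^sub>m k p" using PQ' EP Q' by simp
  finally have QP0': "Q' * P = 0\<^sub>m k p" .
  let ?G = "hcat P P'" and ?H = "vcat Q Q'"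
  have G: "?G \<in> carrier_mat n (p + k)" and H: "?H \<in> carrier_mat (p + k) n" using P P' Q Q' by auto
  have HG: "?H * ?G = 1\<^sub>m (p + k)"
    using vcat_mult_hcat[OF Q Q' P P'] by (simp add: QP QP' QP0 QP0')
  have "P * Q + E = 1\<^sub>m n"
    unfolding E_def using P Q by (intro eq_matI) (simp_all del: index_mult_mat(1))
  then have PQ1: "P * Q + P' * Q' = 1\<^sub>m n" using PQ' by simp
  then have GH: "?G * ?H = 1\<^sub>m n"
    using P Q P' Q' PQ' by (simp add: hcat_mult_vcat)
  have n: "p + k = n" using dim_le_of_mult_eq_one[OF H G HG] dim_le_of_mult_eq_one[OF G H GH] by simp
  from that[OF n P' Q' QP' QP0 QP0' PQ1] show thesis .
qed

text \<open>The image of \<open>P\<close> and the kernel of \<open>Q\<close> are complementary, and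
  both are invariant under \<open>a\<close>. The hypotheses force \<open>u' = u\<close>; a separate
  \<open>u'\<close> spares the caller the proof of this.\<close>

lemma similar_dsum_of_retract:
  fixes a :: "'d :: division_ring mat"
  assumes a: "a \<in> carrier_mat n n" and u: "u \<in> carrier_mat p p" "u' \<in> carrier_mat p p"
    and P: "P \<in> carrier_mat n p" and Q: "Q \<in> carrier_mat p n"
    and QP: "Q * P = 1\<^sub>m p" and aP: "a * P = P * u" and Qa: "Q * a = u' * Q"
  obtains k a' where "p + k = n" "a' \<in> carrier_mat k k" "similar_mat a (dsum u a')"
proof -
  from retract_complement[OF P Q QP] obtain k P' Q' where n: "p + k = n" and
    P': "P' \<in> carrier_mat n k" and Q': "Q' \<in> carrier_mat k n" and QP': "Q' * P' = 1\<^sub>m k" and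
    QP0: "Q * P' = 0\<^sub>m p k" and QP0': "Q' * P = 0\<^sub>m k p" and PQ1: "P * Q + P' * Q' = 1\<^sub>m n" .
  let ?G = "hcat P P'" and ?H = "vcat Q Q'"
  have G: "?G \<in> carrier_mat n (p + k)" and H: "?H \<in> carrier_mat (p + k) n" using P P' Q Q' by auto
  have HG: "?H * ?G = 1\<^sub>m (p + k)"
    using vcat_mult_hcat[OF Q Q' P P'] by (simp add: QP QP' QP0 QP0')
  have GH: "?G * ?H = 1\<^sub>m n" using hcat_mult_vcat[OF P P' Q Q'] PQ1 by simp
  define a' where "a' = Q' * (a * P')"
  have a': "a' \<in> carrier_mat k k" unfolding a'_def using P' Q' a by auto
  have "?H * (a * ?G) = four_block_mat (Q * (a * P)) (Q * (a * P')) (Q' * (a * P)) (Q' * (a * P'))"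
    using P P' Q Q' a by (subst mult_hcat, auto, subst vcat_mult_hcat) auto
  also have "Q * (a * P) = u" using QP P Q u by (simp add: aP assoc_mult_mat_dim[symmetric])
  also have "Q * (a * P') = (u' * Q) * P'" using Q a P' by (simp add: Qa[symmetric] assoc_mult_mat_dim)
  also have "\<dots> = 0\<^sub>m p k" using QP0 u Q P' by (simp add: assoc_mult_mat_dim)
  also have "Q' * (a * P) = 0\<^sub>m k p" using QP0' P Q' u by (simp add: aP assoc_mult_mat_dim[symmetric])
  finally have HaG: "?H * (a * ?G) = dsum u a'" unfolding a'_def[symmetric] dsum_def using u a' by simp
  have "?G * dsum u a' * ?H = (?G * ?H) * a * (?G * ?H)" unfolding HaG[symmetric]
    using G H a by (simp add: assoc_mult_mat_dim)
  then have "a = ?G * dsum u a' * ?H" using a by (simp add: GH)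
  with G H HG GH a u a' n have "similar_mat a (dsum u a')"
    by (intro similar_matI[of _ _ ?G ?H n]) auto
  with n a' that show thesis by blast
qed

section \<open>Elementary equivalence\<close>

text \<open>The relation \<open>\<sim>\<^sub>1\<close> with rectangular factors, so that the sizes of the two square matrices may differ.\<close>

definition elem_equiv :: "'a :: semiring_1 mat \<Rightarrow> 'a mat \<Rightarrow> bool" where
  "elem_equiv A B \<longleftrightarrow> (\<exists>C D. C \<in> carrier_mat (dim_row A) (dim_row B) \<and>
    D \<in> carrier_mat (dim_row B) (dim_row A) \<and> A = C * D \<and> B = D * C)"

lemma elem_equivI:
  "C \<in> carrier_mat n m \<Longrightarrow> D \<in> carrier_mat m n \<Longrightarrow> A = C * D \<Longrightarrow> B = D * C \<Longrightarrow> elem_equiv A B"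
  unfolding elem_equiv_def by auto

lemma elem_equivE:
  assumes "elem_equiv A B"
  obtains n m C D where "A \<in> carrier_mat n n" "B \<in> carrier_mat m m" "C \<in> carrier_mat n m"
    "D \<in> carrier_mat m n" "A = C * D" "B = D * C"
proof -
  from assms obtain C D where "C \<in> carrier_mat (dim_row A) (dim_row B)"
    "D \<in> carrier_mat (dim_row B) (dim_row A)" "A = C * D" "B = D * C"
    unfolding elem_equiv_def by blast
  moreover from this have "A \<in> carrier_mat (dim_row A) (dim_row A)"
    "B \<in> carrier_mat (dim_row B) (dim_row B)" by (metis mult_carrier_mat)+
  ultimately show thesis using that by blast
qed

lemma elem_equiv_sym: "elem_equiv A B \<Longrightarrow> elem_equiv B A"
  unfolding elem_equiv_def by blast

lemma elem_equiv_refl: "A \<in> carrier_mat n n \<Longrightarrow> elem_equiv A A"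
  by (rule elem_equivI[of A n n "1\<^sub>m n"]) auto

text \<open>The conjugating matrices are absorbed into the two factors.\<close>

lemma elem_equiv_similar:
  assumes "elem_equiv A B" "similar_mat B B'"
  shows "elem_equiv A B'"
proof -
  from assms(1) obtain n m C D where A: "A \<in> carrier_mat n n" "B \<in> carrier_mat m m" "C \<in> carrier_mat n m"
    "D \<in> carrier_mat m n" "A = C * D" "B = D * C" by (rule elem_equivE)
  from similar_matD[OF assms(2)] A(2) obtain P Q where PQ: "P \<in> carrier_mat m m" "Q \<in> carrier_mat m m"
    "B' \<in> carrier_mat m m" "P * Q = 1\<^sub>m m" "Q * P = 1\<^sub>m m" "B = P * B' * Q"
    by (metis carrier_matD(1) insert_subset)
  have "(C * P) * (Q * D) = C * (P * Q) * D" using A(2-4) PQ(1-3) by (simp add: assoc_mult_mat_dim)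
  then have 1: "A = (C * P) * (Q * D)" using A(3-5) PQ(4) by simp
  have "(Q * D) * (C * P) = Q * B * P" using A(3,4) PQ(1-3) by (simp add: assoc_mult_mat_dim A(6))
  also have "\<dots> = (Q * P) * B' * (Q * P)" using A(2-4) PQ(1-3) by (simp add: assoc_mult_mat_dim PQ(6))
  finally have 2: "B' = (Q * D) * (C * P)" using PQ(3,5) by simp
  show ?thesis by (rule elem_equivI[OF _ _ 1 2, of n m]) (use A PQ in auto)
qed

lemma elem_equiv_if_similar:
  assumes "similar_mat A B"
  shows "elem_equiv A B"
proof -
  from similar_matD[OF assms] obtain n where "A \<in> carrier_mat n n" by blast
  from elem_equiv_similar[OF elem_equiv_refl[OF this] assms] show ?thesis .
qed

lemma elem_equiv_dsum:
  assumes "elem_equiv A B" "elem_equiv A' B'"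
  shows "elem_equiv (dsum A A') (dsum B B')"
proof -
  from assms(1) obtain n m C D where 1: "C \<in> carrier_mat n m"
    "D \<in> carrier_mat m n" "A = C * D" "B = D * C" by (rule elem_equivE)
  from assms(2) obtain n' m' C' D' where 2: "C' \<in> carrier_mat n' m'"
    "D' \<in> carrier_mat m' n'" "A' = C' * D'" "B' = D' * C'" by (rule elem_equivE)
  show ?thesis
    by (rule elem_equivI[of "dsum C C'" "n + n'" "m + m'" "dsum D D'"]) (use 1 2 in \<open>auto simp: dsum_mult\<close>)
qed

text \<open>
  Both relations end in a similarity, so that conjugating an end point costs no step of its own;
  a chain without steps is the only case in which the similarity itself must be counted as one
  (hence \<open>max 1 r\<close> below).
\<close>

primrec shrinks :: "nat \<Rightarrow> 'a :: semiring_1 mat \<Rightarrow> 'a mat \<Rightarrow> bool" where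
  "shrinks 0 A C \<longleftrightarrow> similar_mat A C"
| "shrinks (Suc r) A C \<longleftrightarrow> (\<exists>B. dim_row A = Suc (dim_row B) \<and> elem_equiv A B \<and> shrinks r B C)"

primrec chain :: "nat \<Rightarrow> 'a :: semiring_1 mat \<Rightarrow> 'a mat \<Rightarrow> bool" where
  "chain 0 A C \<longleftrightarrow> similar_mat A C"
| "chain (Suc r) A C \<longleftrightarrow> (\<exists>B. dim_row A = dim_row B \<and> elem_equiv A B \<and> chain r B C)"

lemma similar_mat_carrier: "similar_mat A B \<Longrightarrow> A \<in> carrier_mat n n \<Longrightarrow> B \<in> carrier_mat n n"
  by (drule similar_matD) auto

lemma shrinks_carrierE:
  assumes "shrinks r A C"
  obtains k where "C \<in> carrier_mat k k" "A \<in> carrier_mat (r + k) (r + k)"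
proof -
  have "\<exists>k. C \<in> carrier_mat k k \<and> A \<in> carrier_mat (r + k) (r + k)"
    using assms
  proof (induction r arbitrary: A)
    case 0
    then show ?case by (auto dest!: similar_matD)
  next
    case (Suc r)
    from Suc.prems obtain B where B: "dim_row A = Suc (dim_row B)" "elem_equiv A B" "shrinks r B C" by auto
    from Suc.IH[OF B(3)] obtain k where "C \<in> carrier_mat k k" "B \<in> carrier_mat (r + k) (r + k)" by blast
    with B(1,2) show ?case by (auto elim!: elem_equivE intro!: exI[of _ k])
  qed
  with that show thesis by blast
qed

text \<open>The similarity is absorbed into the first step, or into the final similarity if there is
  no step.\<close>

lemma similar_shrinks:
  assumes "similar_mat A A'" "shrinks r A' C"
  shows "shrinks r A C"
proof (cases r)
  case 0
  with assms similar_mat_trans show ?thesis by auto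
next
  case (Suc s)
  with assms obtain B where "dim_row A' = Suc (dim_row B)" "elem_equiv A' B" "shrinks s B C" by auto
  moreover have "elem_equiv A B"
    using elem_equiv_similar[OF elem_equiv_sym[OF \<open>elem_equiv A' B\<close>] similar_mat_sym[OF assms(1)]]
    by (rule elem_equiv_sym)
  moreover have "dim_row A = dim_row A'" using similar_matD[OF assms(1)] by auto
  ultimately show ?thesis using Suc by auto
qed

lemma shrinks_trans: "shrinks r A B \<Longrightarrow> shrinks s B C \<Longrightarrow> shrinks (r + s) A C"
  by (induction r arbitrary: A) (auto intro: similar_shrinks)

lemma shrinks_dsum:
  assumes "shrinks r A C" "M \<in> carrier_mat m m"
  shows "shrinks r (dsum A M) (dsum C M)"
  using assms(1)
proof (induction r arbitrary: A)
  case 0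
  then show ?case using similar_dsum similar_mat_refl[OF assms(2)] by auto
next
  case (Suc r)
  then obtain B where B: "dim_row A = Suc (dim_row B)" "elem_equiv A B" "shrinks r B C" by auto
  have "elem_equiv (dsum A M) (dsum B M)" using B(2) elem_equiv_dsum elem_equiv_refl[OF assms(2)] by blast
  with B Suc.IH[OF B(3)] show ?case by (auto intro!: exI[of _ "dsum B M"])
qed

lemma shrinks_dsum':
  assumes "shrinks r A C" "M \<in> carrier_mat m m"
  shows "shrinks r (dsum M A) (dsum M C)"
  using assms(1)
proof (induction r arbitrary: A)
  case 0
  then show ?case using similar_dsum similar_mat_refl[OF assms(2)] by auto
next
  case (Suc r)
  then obtain B where B: "dim_row A = Suc (dim_row B)" "elem_equiv A B" "shrinks r B C" by auto
  have "elem_equiv (dsum M A) (dsum M B)" using B(2) elem_equiv_dsum elem_equiv_refl[OF assms(2)] by blast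
  with B Suc.IH[OF B(3)] show ?case by (auto intro!: exI[of _ "dsum M B"])
qed

text \<open>The recursion exposes the first step, while running a shrinking backwards requires the
  last one; the final similarity is merged into it.\<close>

lemma shrinks_SucE:
  assumes "shrinks (Suc r) A C"
  obtains B where "shrinks r A B" "dim_row B = Suc (dim_row C)" "elem_equiv B C"
proof -
  have "\<exists>B. shrinks r A B \<and> dim_row B = Suc (dim_row C) \<and> elem_equiv B C" using assms
  proof (induction r arbitrary: A)
    case 0
    then obtain B where B: "dim_row A = Suc (dim_row B)" "elem_equiv A B" "similar_mat B C" by auto
    from B(2) have "similar_mat A A" by (auto elim!: elem_equivE intro: similar_mat_refl)
    moreover have "dim_row B = dim_row C" using similar_matD[OF B(3)] by auto
    ultimately show ?case using B elem_equiv_similar[OF B(2,3)] by auto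
  next
    case (Suc r)
    then obtain B where "dim_row A = Suc (dim_row B)" "elem_equiv A B" "shrinks (Suc r) B C" by auto
    with Suc.IH[of B] show ?case by auto
  qed
  with that show thesis by blast
qed

text \<open>Shrinking the first summand one row at a time while the second one grows keeps the total size fixed.\<close>

lemma chain_of_shrinks:
  assumes "shrinks r A C" "shrinks r B D"
  shows "chain r (dsum A D) (dsum C B)"
  using assms
proof (induction r arbitrary: A D)
  case 0
  then show ?case by (auto intro: similar_dsum similar_mat_sym)
next
  case (Suc r)
  from Suc.prems(1) obtain A1 where A1: "dim_row A = Suc (dim_row A1)" "elem_equiv A A1" "shrinks r A1 C" by auto
  from shrinks_SucE[OF Suc.prems(2)] obtain D1 where
    D1: "shrinks r B D1" "dim_row D1 = Suc (dim_row D)" "elem_equiv D1 D" by blast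
  have "elem_equiv (dsum A D) (dsum A1 D1)"
    using A1 D1 by (intro elem_equiv_dsum elem_equiv_sym[of D1])
  with Suc.IH[OF A1(3) D1(1)] A1 D1 show ?case by (auto intro!: exI[of _ "dsum A1 D1"])
qed

lemma sim1_iff_elem_equiv:
  assumes "A \<in> carrier_mat n n" "B \<in> carrier_mat n n"
  shows "sim1 (ring_mat TYPE('a :: semiring_1) n b) A B \<longleftrightarrow> elem_equiv A B"
  using assms unfolding sim1_def elem_equiv_def by (auto simp: ring_mat_simps)

lemma chain_similar: "chain r A B \<Longrightarrow> similar_mat B C \<Longrightarrow> chain r A C"
  by (induction r arbitrary: A) (auto intro: similar_mat_trans)

lemma sim_n_of_chain:
  fixes A :: "'a :: semiring_1 mat"
  assumes "chain r A B" "A \<in> carrier_mat n n"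
  shows "sim_n (ring_mat TYPE('a) n b) (max 1 r) A B"
proof -
  let ?R = "ring_mat TYPE('a) n b"
  have step: "elem_equiv A B \<Longrightarrow> A \<in> carrier_mat n n \<Longrightarrow> dim_row B = n \<Longrightarrow> B \<in> carrier ?R \<and> sim1 ?R A B" for A B
    using sim1_iff_elem_equiv[of A n B b] by (auto elim!: elem_equivE simp: ring_mat_simps)
  have one: "sim_n ?R 1 A B" if "chain 0 A B" "A \<in> carrier_mat n n" for A B
    using that step[of A B] elem_equiv_if_similar[of A B] similar_mat_carrier[of A B n] by auto
  have "sim_n ?R (Suc r) A B" if "chain (Suc r) A B" "A \<in> carrier_mat n n" for r A
    using that
  proof (induction r arbitrary: A)
    case 0
    then obtain C where C: "dim_row A = dim_row C" "elem_equiv A C" "similar_mat C B" by auto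
    then have "elem_equiv A B" "dim_row B = n" using 0(2) elem_equiv_similar[of A C B] similar_matD[OF C(3)] by auto
    with step[of A B] 0(2) show ?case by auto
  next
    case (Suc r)
    then obtain C where C: "dim_row A = dim_row C" "elem_equiv A C" "chain (Suc r) C B" by auto
    with step[of A C] Suc.prems(2) have "C \<in> carrier ?R" "sim1 ?R A C" by auto
    moreover from this have "C \<in> carrier_mat n n" by (simp add: ring_mat_simps)
    from Suc.IH[OF C(3) this] have "sim_n ?R (Suc r) C B" .
    ultimately show ?case by (simp only: sim_n.simps(2)[of _ "Suc r"]) blast
  qed
  from this[of "r - 1" A] one[of A B] assms show ?thesis by (cases r) auto
qed

section \<open>Shift equivalence\<close>

text \<open>Shift equivalence of lag \<open>r\<close> in the sense of Williams, from symbolic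
  dynamics. Unlike a chain of steps it compares two matrices directly, whatever their sizes.\<close>

definition shift_equiv :: "nat \<Rightarrow> 'a :: semiring_1 mat \<Rightarrow> 'a mat \<Rightarrow> bool" where
  "shift_equiv r A B \<longleftrightarrow> (\<exists>n m R S. A \<in> carrier_mat n n \<and> B \<in> carrier_mat m m \<and>
    R \<in> carrier_mat n m \<and> S \<in> carrier_mat m n \<and>
    A * R = R * B \<and> S * A = B * S \<and> R * S = A ^\<^sub>m r \<and> S * R = B ^\<^sub>m r)"

lemma shift_equivE:
  assumes "shift_equiv r A B" "A \<in> carrier_mat n n" "B \<in> carrier_mat m m"
  obtains R S where "R \<in> carrier_mat n m" "S \<in> carrier_mat m n"
    "A * R = R * B" "S * A = B * S" "R * S = A ^\<^sub>m r" "S * R = B ^\<^sub>m r"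
proof -
  from assms(1) obtain n' m' R S where *: "A \<in> carrier_mat n' n'" "B \<in> carrier_mat m' m'"
    "R \<in> carrier_mat n' m'" "S \<in> carrier_mat m' n'"
    "A * R = R * B" "S * A = B * S" "R * S = A ^\<^sub>m r" "S * R = B ^\<^sub>m r"
    unfolding shift_equiv_def by (elim exE conjE)
  from *(1,2) assms(2,3) have "n' = n" "m' = m" by auto
  from that[OF *(3-8)[unfolded this]] show thesis .
qed

lemma pow_mat_carrier[simp]: "A \<in> carrier_mat n n \<Longrightarrow> A ^\<^sub>m r \<in> carrier_mat n n"
  by auto

lemma pow_mat_add:
  assumes "A \<in> carrier_mat n n"
  shows "A ^\<^sub>m (r + s) = A ^\<^sub>m r * A ^\<^sub>m s"
  using assms by (induction s) (auto simp: assoc_mult_mat_dim)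

lemma pow_mat_intertwine:
  assumes "A \<in> carrier_mat n n" "B \<in> carrier_mat m m" "R \<in> carrier_mat n m" "A * R = R * B"
  shows "A ^\<^sub>m s * R = R * B ^\<^sub>m s"
proof (induction s)
  case (Suc s)
  have "A ^\<^sub>m Suc s * R = A ^\<^sub>m s * (A * R)" using assms(1-3) by (simp add: assoc_mult_mat_dim)
  also have "\<dots> = (A ^\<^sub>m s * R) * B" using assms by (simp add: assoc_mult_mat_dim)
  also have "\<dots> = R * B ^\<^sub>m Suc s" using Suc assms(1-3) by (simp add: assoc_mult_mat_dim)
  finally show ?case .
qed (use assms in auto)

lemma shift_equiv_trans:
  assumes "shift_equiv r A B" "shift_equiv s B C"
  shows "shift_equiv (r + s) A C"
proof -
  from assms(1) obtain n m R S where 1: "A \<in> carrier_mat n n" "B \<in> carrier_mat m m"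
    "R \<in> carrier_mat n m" "S \<in> carrier_mat m n"
    "A * R = R * B" "S * A = B * S" "R * S = A ^\<^sub>m r" "S * R = B ^\<^sub>m r"
    unfolding shift_equiv_def by (elim exE conjE)
  from assms(2) obtain l where 2: "C \<in> carrier_mat l l" unfolding shift_equiv_def by (elim exE conjE)
  from shift_equivE[OF assms(2) 1(2) 2] obtain T U where T: "T \<in> carrier_mat m l" "U \<in> carrier_mat l m"
    "B * T = T * C" "U * B = C * U" "T * U = B ^\<^sub>m s" "U * T = C ^\<^sub>m s" .
  note 2 = 2 T
  have a: "A * (R * T) = (R * T) * C"
  proof -
    have "A * (R * T) = (A * R) * T" using 1(1-4) 2(1-3) by (simp add: assoc_mult_mat_dim)
    also have "\<dots> = R * (B * T)" using 1(1-4) 2(1-3) by (simp add: 1(5) assoc_mult_mat_dim)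
    also have "\<dots> = (R * T) * C" using 1(1-4) 2(1-3) by (simp add: 2(4) assoc_mult_mat_dim)
    finally show ?thesis .
  qed
  have b: "(U * S) * A = C * (U * S)"
  proof -
    have "(U * S) * A = U * (S * A)" using 1(1-4) 2(1-3) by (simp add: assoc_mult_mat_dim)
    also have "\<dots> = (U * B) * S" using 1(1-4) 2(1-3) by (simp add: 1(6) assoc_mult_mat_dim)
    also have "\<dots> = C * (U * S)" using 1(1-4) 2(1-3) by (simp add: 2(5) assoc_mult_mat_dim)
    finally show ?thesis .
  qed
  have c: "(R * T) * (U * S) = A ^\<^sub>m (r + s)"
  proof -
    have "(R * T) * (U * S) = (R * (T * U)) * S" using 1(1-4) 2(1-3) by (simp add: assoc_mult_mat_dim)
    \<comment> \<open>The inner product \<open>T * U\<close> is a power of \<open>B\<close>, which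
      crosses \<open>R\<close> and becomes the same power of \<open>A\<close>; hence the lags
      add.\<close>
    also have "\<dots> = (A ^\<^sub>m s * R) * S" unfolding 2(6) pow_mat_intertwine[OF 1(1-3,5)] ..
    also have "\<dots> = A ^\<^sub>m s * A ^\<^sub>m r" unfolding 1(7)[symmetric] using 1(1-4) by (simp add: assoc_mult_mat_dim)
    finally show ?thesis using pow_mat_add[OF 1(1)] by (metis add.commute)
  qed
  have d: "(U * S) * (R * T) = C ^\<^sub>m (r + s)"
  proof -
    have "(U * S) * (R * T) = U * ((S * R) * T)" using 1(1-4) 2(1-3) by (simp add: assoc_mult_mat_dim)
    also have "\<dots> = U * (T * C ^\<^sub>m r)" unfolding 1(8) pow_mat_intertwine[OF 1(2) 2(1,2,4)] ..
    also have "\<dots> = C ^\<^sub>m s * C ^\<^sub>m r" unfolding 2(7)[symmetric] using 2(1-3) by (simp add: assoc_mult_mat_dim)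
    finally show ?thesis using pow_mat_add[OF 2(1)] by (metis add.commute)
  qed
  show ?thesis unfolding shift_equiv_def
    by (intro exI[of _ n] exI[of _ l] exI[of _ "R * T"] exI[of _ "U * S"] conjI 1(1) 2(1) a b c d)
      (use 1(3,4) 2(2,3) in auto)
qed

lemma shift_equiv_sym: "shift_equiv r A B \<Longrightarrow> shift_equiv r B A"
  unfolding shift_equiv_def by metis

lemma shift_equiv_refl: "A \<in> carrier_mat n n \<Longrightarrow> shift_equiv 0 A A"
  unfolding shift_equiv_def
  by (intro exI[of _ n] exI[of _ "1\<^sub>m n"]) auto

lemma shift_equiv_of_elem_equiv:
  assumes "elem_equiv A B"
  shows "shift_equiv 1 A B"
proof -
  from assms obtain n m C D where 1: "A \<in> carrier_mat n n" "B \<in> carrier_mat m m" "C \<in> carrier_mat n m"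
    "D \<in> carrier_mat m n" "A = C * D" "B = D * C" by (rule elem_equivE)
  have "A * C = C * B" "D * A = B * D" using 1(3,4) unfolding 1(5,6) by (simp_all add: assoc_mult_mat_dim)
  moreover have "C * D = A ^\<^sub>m 1" "D * C = B ^\<^sub>m 1" using 1 by simp_all
  ultimately show ?thesis unfolding shift_equiv_def using 1(1-4) by blast
qed

lemma shift_equiv_of_shrinks:
  assumes "shrinks r A C"
  obtains s where "shift_equiv s A C"
proof -
  have "\<exists>s. shift_equiv s A C" using assms
  proof (induction r arbitrary: A)
    case 0
    then have "shift_equiv 1 A C" by (intro shift_equiv_of_elem_equiv elem_equiv_if_similar) simp
    then show ?case ..
  next
    case (Suc r)
    then obtain B where "elem_equiv A B" "shrinks r B C" by auto
    with Suc.IH show ?case by (blast intro: shift_equiv_trans shift_equiv_of_elem_equiv)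
  qed
  with that show thesis by blast
qed

text \<open>Here the lag equals the number of steps exactly; the lower bound for the diameter rests
  on this.\<close>

lemma shift_equiv_of_sim_n:
  fixes A :: "'a :: semiring_1 mat"
  assumes "sim_n (ring_mat TYPE('a) n b) r A B" "A \<in> carrier_mat n n"
  shows "shift_equiv r A B"
  using assms
proof (induction r arbitrary: A)
  case 0
  then show ?case using shift_equiv_refl by auto
next
  case (Suc r)
  then obtain C where C: "C \<in> carrier_mat n n" "sim1 (ring_mat TYPE('a) n b) A C"
    "sim_n (ring_mat TYPE('a) n b) r C B" by (auto simp: ring_mat_simps)
  have "elem_equiv A C" by (rule sim1_iff_elem_equiv[OF Suc.prems(2) C(1), THEN iffD1, OF C(2)])
  from shift_equiv_trans[OF shift_equiv_of_elem_equiv[OF this] Suc.IH[OF C(3,1)]] show ?case by simp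
qed

section \<open>Invertible cores\<close>

lemma invertible_pow_mat:
  assumes "invertible_mat A" "A \<in> carrier_mat n n"
  shows "invertible_mat (A ^\<^sub>m r)"
proof -
  from invertible_matE[OF assms] obtain B where B: "B \<in> carrier_mat n n" "A * B = 1\<^sub>m n" "B * A = 1\<^sub>m n" .
  have "\<exists>C\<in>carrier_mat n n. A ^\<^sub>m r * C = 1\<^sub>m n \<and> C * A ^\<^sub>m r = 1\<^sub>m n"
  proof (induction r)
    case 0
    then show ?case using assms(2) by (intro bexI[of _ "1\<^sub>m n"]) auto
  next
    case (Suc r)
    then obtain C where C: "C \<in> carrier_mat n n" "A ^\<^sub>m r * C = 1\<^sub>m n" "C * A ^\<^sub>m r = 1\<^sub>m n" by auto
    have "A ^\<^sub>m Suc r * (B * C) = A ^\<^sub>m r * ((A * B) * C)" using assms(2) B(1) C(1)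
      by (simp add: assoc_mult_mat_dim)
    moreover have "(B * C) * A ^\<^sub>m Suc r = B * ((C * A ^\<^sub>m r) * A)" using assms(2) B(1) C(1)
      by (simp add: assoc_mult_mat_dim)
    ultimately show ?case using assms(2) B C by (intro bexI[of _ "B * C"]) auto
  qed
  with invertible_matI[OF pow_mat_carrier[OF assms(2)]] show ?thesis by blast
qed

text \<open>Both products of \<open>R\<close> and \<open>S\<close> are powers of invertible
  matrices, so \<open>R\<close> has inverses on both sides, is square, and its intertwining relation
  becomes a conjugation.\<close>

lemma similar_of_shift_equiv_invertible:
  fixes U V :: "'d :: division_ring mat"
  assumes "shift_equiv r U V" "invertible_mat U" "invertible_mat V"
  shows "similar_mat U V"
proof -
  from assms(1) obtain n m R S where 1: "U \<in> carrier_mat n n" "V \<in> carrier_mat m m"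
    "R \<in> carrier_mat n m" "S \<in> carrier_mat m n"
    "U * R = R * V" "S * U = V * S" "R * S = U ^\<^sub>m r" "S * R = V ^\<^sub>m r"
    unfolding shift_equiv_def by (elim exE conjE)
  from invertible_matE[OF invertible_pow_mat[OF assms(2) 1(1)] pow_mat_carrier[OF 1(1)]]
  obtain X where X: "X \<in> carrier_mat n n" "U ^\<^sub>m r * X = 1\<^sub>m n" by blast
  from invertible_matE[OF invertible_pow_mat[OF assms(3) 1(2)] pow_mat_carrier[OF 1(2)]]
  obtain Y where Y: "Y \<in> carrier_mat m m" "Y * V ^\<^sub>m r = 1\<^sub>m m" by blast
  let ?Q = "S * X"
  have RQ: "R * ?Q = 1\<^sub>m n" using X 1(3,4,7) by (simp add: assoc_mult_mat_dim[symmetric])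
  have YR: "(Y * S) * R = 1\<^sub>m m" using Y 1(3,4,8) by (simp add: assoc_mult_mat_dim)
  \<comment> \<open>The right inverse \<open>?Q\<close> of \<open>R\<close> coincides with the left
    inverse \<open>Y * S\<close>.\<close>
  have "?Q = ((Y * S) * R) * ?Q" unfolding YR using X 1 by simp
  also have "\<dots> = (Y * S) * (R * ?Q)" using 1(3,4) X(1) Y(1) by (simp add: assoc_mult_mat_dim)
  also have "\<dots> = Y * S" unfolding RQ using 1(3,4) Y(1) by simp
  finally have QR: "?Q * R = 1\<^sub>m m" using YR by simp
  have "n = m"
    using dim_le_of_mult_eq_one[OF _ _ RQ, of m] dim_le_of_mult_eq_one[OF _ _ QR, of n] 1(3,4) X(1) by simp
  have "R * V * ?Q = U * (R * ?Q)" unfolding 1(5)[symmetric] using 1(1-4) X(1) by (simp add: assoc_mult_mat_dim)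
  also have "\<dots> = U" unfolding RQ using 1(1) by simp
  finally have "U = R * V * ?Q" ..
  then show ?thesis using 1(1-4) X(1) RQ QR \<open>n = m\<close> by (intro similar_matI[of _ _ R ?Q n]) auto
qed

text \<open>If \<open>x * A = 0\<close> with \<open>x\<close> nonzero, choose \<open>y\<close> with
  \<open>x * y = 1\<close> and split the identity as \<open>y * x + P * Q\<close>. The first summand
  annihilates \<open>A\<close>, so \<open>A = P * (Q * A)\<close> factors through size
  \<open>n - 1\<close>, and the induction continues with \<open>(Q * A) * P\<close>.\<close>

lemma exists_shrinks_invertible:
  fixes A :: "'d :: division_ring mat"
  assumes "A \<in> carrier_mat n n"
  obtains r U where "shrinks r A U" "invertible_mat U"
proof -
  have "\<exists>r U. shrinks r A U \<and> invertible_mat U" using assms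
  proof (induction n arbitrary: A rule: less_induct)
    case (less n)
    show ?case
    proof (cases "invertible_mat A")
      case True
      then show ?thesis using similar_mat_refl[OF less.prems] by (intro exI[of _ 0]) auto
    next
      case False
      with invertible_if_no_left_null[OF less.prems] obtain x where
        x: "x \<in> carrier_mat 1 n" "x * A = 0\<^sub>m 1 n" "x \<noteq> 0\<^sub>m 1 n" by blast
      have "x = 0\<^sub>m 1 n" if "\<And>i. i < n \<Longrightarrow> x $$ (0, i) = 0"
        using that x(1) by (intro eq_matI) auto
      with x(3) obtain i where i: "i < n" "x $$ (0, i) \<noteq> 0" by blast
      define y where "y = mat n 1 (\<lambda>(l, _). if l = i then inverse (x $$ (0, i)) else 0)"
      have y: "y \<in> carrier_mat n 1" unfolding y_def by simp
      have "(\<Sum>l<n. x $$ (0, l) * y $$ (l, 0)) = (\<Sum>l<n. if l = i then 1 else 0)"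
        by (rule sum.cong) (use i in \<open>auto simp: y_def\<close>)
      then have "x * y = 1\<^sub>m 1" using x y i
        by (intro eq_matI) (auto simp: index_mult_mat_sum[OF x(1) y] simp del: index_mult_mat(1))
      from retract_complement[OF y x(1) this] obtain k P Q where k: "1 + k = n" and
        P: "P \<in> carrier_mat n k" and Q: "Q \<in> carrier_mat k n" and PQ: "y * x + P * Q = 1\<^sub>m n" by metis
      have "A = (y * x + P * Q) * A" unfolding PQ using less.prems by simp
      also have "\<dots> = y * (x * A) + P * (Q * A)" using x(1) y P Q less.prems
        by (simp add: add_mult_distrib_mat[of _ n n] assoc_mult_mat_dim)
      also have "\<dots> = P * (Q * A)" using x(2) y P Q less.prems by simp
      finally have A: "A = P * (Q * A)" .
      have e: "elem_equiv A ((Q * A) * P)"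
        by (rule elem_equivI[OF P _ A refl]) (use Q less.prems in auto)
      have B: "(Q * A) * P \<in> carrier_mat k k" using P Q less.prems by auto
      from less.IH[OF _ B] k obtain r U where "shrinks r ((Q * A) * P) U" "invertible_mat U" by auto
      moreover have "dim_row A = Suc (dim_row ((Q * A) * P))" using Q less.prems k by simp
      ultimately have "shrinks (Suc r) A U \<and> invertible_mat U" using e unfolding shrinks.simps by blast
      then show ?thesis by blast
    qed
  qed
  with that show thesis by blast
qed

section \<open>Splitting off the invertible part or a nilpotent Jordan block\<close>

definition shift_mat :: "nat \<Rightarrow> 'a :: semiring_1 mat" where
  "shift_mat n = mat n n (\<lambda>(i, j). if j = Suc i then 1 else 0)"

lemma shift_mat_carrier[simp]: "shift_mat n \<in> carrier_mat n n"
  unfolding shift_mat_def by simp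

lemma dim_shift_mat[simp]: "dim_row (shift_mat n) = n" "dim_col (shift_mat n) = n"
  unfolding shift_mat_def by simp_all

lemma shift_mat_pow:
  "shift_mat n ^\<^sub>m r = (mat n n (\<lambda>(i, j). if j = i + r then 1 else 0) :: 'a :: semiring_1 mat)"
proof (induction r)
  case 0
  then show ?case by (intro eq_matI) (auto simp: shift_mat_def)
next
  case (Suc r)
  have "(mat n n (\<lambda>(i, j). if j = i + r then 1 else 0) * shift_mat n) $$ (i, j) = (if j = i + Suc r then 1 else (0 :: 'a))"
    if "i < n" "j < n" for i j
  proof -
    have "(mat n n (\<lambda>(i, j). if j = i + r then 1 else 0) * shift_mat n) $$ (i, j)
        = (\<Sum>l<n. if l = i + r then if j = Suc l then 1 else 0 else (0 :: 'a))"
      unfolding index_mult_mat_sum[OF mat_carrier shift_mat_carrier that]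
      by (rule sum.cong) (use that in \<open>auto simp: shift_mat_def\<close>)
    then show ?thesis using that by (simp add: sum.delta)
  qed
  then show ?case using Suc by (intro eq_matI) (auto simp: shift_mat_def simp del: index_mult_mat(1))
qed

lemma shrinks_shift_mat: "shrinks r (shift_mat (r + q) :: 'a :: semiring_1 mat) (shift_mat q)"
proof (induction r)
  case 0
  then show ?case by (auto intro: similar_mat_refl shift_mat_carrier)
next
  case (Suc r)
  let ?p = "r + q"
  \<comment> \<open>\<open>?C\<close> is the identity with a zero row added below, \<open>?D\<close>
    the identity with a zero column added on the left; their products in the two orders are the
    shifts of sizes \<open>Suc ?p\<close> and \<open>?p\<close>.\<close>
  let ?C = "mat (Suc ?p) ?p (\<lambda>(i, j). if i = j then 1 else 0) :: 'a mat"
  let ?D = "mat ?p (Suc ?p) (\<lambda>(i, j). if j = Suc i then 1 else 0) :: 'a mat"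
  have "(?C * ?D) $$ (i, j) = (if j = Suc i then 1 else 0)" if "i < Suc ?p" "j < Suc ?p" for i j
  proof -
    have "(?C * ?D) $$ (i, j) = (\<Sum>l<?p. if l = i then if j = Suc l then 1 else 0 else 0)"
      unfolding index_mult_mat_sum[OF mat_carrier mat_carrier that] by (rule sum.cong) (use that in auto)
    then show ?thesis using that by (auto simp: sum.delta)
  qed
  then have CD: "shift_mat (Suc ?p) = ?C * ?D"
    by (intro eq_matI) (auto simp: shift_mat_def simp del: index_mult_mat(1))
  have "(?D * ?C) $$ (i, j) = (if j = Suc i then 1 else 0)" if "i < ?p" "j < ?p" for i j
  proof -
    have "(?D * ?C) $$ (i, j) = (\<Sum>l<Suc ?p. if l = j then if l = Suc i then 1 else 0 else 0)"
      unfolding index_mult_mat_sum[OF mat_carrier mat_carrier that] by (rule sum.cong) (use that in auto)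
    then show ?thesis using that by (simp add: sum.delta del: sum.lessThan_Suc)
  qed
  then have DC: "shift_mat ?p = ?D * ?C"
    by (intro eq_matI) (auto simp: shift_mat_def simp del: index_mult_mat(1))
  have "elem_equiv (shift_mat (Suc ?p) :: 'a mat) (shift_mat ?p)"
    by (rule elem_equivI[OF _ _ CD DC]) auto
  moreover have "dim_row (shift_mat (Suc ?p) :: 'a mat) = Suc (dim_row (shift_mat ?p :: 'a mat))"
    by (simp add: shift_mat_def)
  ultimately show ?case using Suc.IH unfolding shrinks.simps add_Suc by blast
qed

text \<open>\<open>S * R\<close> supplies \<open>t\<close> factors of \<open>B\<close>, and the
  remaining \<open>r\<close> factors cross \<open>R\<close> to become a vanishing power of
  \<open>A\<close>. So the exponent grows by at most the lag.\<close>

lemma shift_equiv_nilpotent: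
  assumes "shift_equiv t A B" "A \<in> carrier_mat n n" "A ^\<^sub>m r = 0\<^sub>m n n" "B \<in> carrier_mat m m"
  shows "B ^\<^sub>m (t + r) = 0\<^sub>m m m"
proof -
  from shift_equivE[OF assms(1,2,4)] obtain R S where
    1: "R \<in> carrier_mat n m" "S \<in> carrier_mat m n" "A * R = R * B" "S * R = B ^\<^sub>m t" by metis
  have "B ^\<^sub>m (t + r) = S * (R * B ^\<^sub>m r)" unfolding pow_mat_add[OF assms(4)] 1(4)[symmetric]
    using 1(1,2) assms(4) by (simp add: assoc_mult_mat_dim)
  also have "\<dots> = S * (A ^\<^sub>m r * R)" using pow_mat_intertwine[OF assms(2,4) 1(1,3)] by simp
  also have "\<dots> = 0\<^sub>m m m" using assms(3) 1(1,2) by simp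
  finally show ?thesis .
qed

section \<open>Nilpotence and the empty core\<close>

lemma one_mat_0_eq: "A \<in> carrier_mat 0 0 \<Longrightarrow> A = 1\<^sub>m 0"
  by (intro eq_matI) auto

lemma invertible_one_mat: "invertible_mat (1\<^sub>m n :: 'a :: semiring_1 mat)"
  by (rule invertible_matI[of _ n "1\<^sub>m n"]) auto

lemma invertible_nilpotent_dim:
  fixes U :: "'d :: division_ring mat"
  assumes "invertible_mat U" "U \<in> carrier_mat k k" "U ^\<^sub>m r = 0\<^sub>m k k"
  shows "k = 0"
proof (rule ccontr)
  assume "k \<noteq> 0"
  from invertible_matE[OF invertible_pow_mat[OF assms(1,2)] pow_mat_carrier[OF assms(2)], of r]
  obtain X where "X \<in> carrier_mat k k" "U ^\<^sub>m r * X = 1\<^sub>m k" by blast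
  then have "(0\<^sub>m k k :: 'd mat) = 1\<^sub>m k" using assms(3) by simp
  then have "(0\<^sub>m k k :: 'd mat) $$ (0, 0) = 1\<^sub>m k $$ (0, 0)" by simp
  with \<open>k \<noteq> 0\<close> show False by simp
qed

text \<open>The core is shift equivalent to \<open>A\<close>, hence nilpotent as well as invertible,
  hence of size 0.\<close>

lemma shrinks_empty_of_nilpotent:
  fixes A :: "'d :: division_ring mat"
  assumes "A \<in> carrier_mat n n" "A ^\<^sub>m r = 0\<^sub>m n n"
  shows "shrinks n A (1\<^sub>m 0)"
proof -
  from exists_shrinks_invertible[OF assms(1)] obtain s U where U: "shrinks s A U" "invertible_mat U" .
  from shrinks_carrierE[OF U(1)] obtain k where k: "U \<in> carrier_mat k k" "A \<in> carrier_mat (s + k) (s + k)" .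
  from shift_equiv_of_shrinks[OF U(1)] obtain t where "shift_equiv t A U" .
  from invertible_nilpotent_dim[OF U(2) k(1) shift_equiv_nilpotent[OF this assms k(1)]] have "k = 0" .
  with k assms(1) have "s = n" "U = 1\<^sub>m 0" by (auto intro: one_mat_0_eq)
  with U show ?thesis by simp
qed

lemma nilpotent_of_shrinks_empty:
  fixes A :: "'d :: division_ring mat"
  assumes "shrinks n A (1\<^sub>m 0)" "A \<in> carrier_mat n n"
  obtains r where "A ^\<^sub>m r = 0\<^sub>m n n"
proof -
  from shift_equiv_of_shrinks[OF assms(1)] obtain t where "shift_equiv t A (1\<^sub>m 0)" .
  from shift_equiv_sym[OF this] one_carrier_mat
  \<comment> \<open>The empty matrix vanishes already at exponent 0, so the lag itself is an
    exponent that annihilates \<open>A\<close>.\<close>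
  have "A ^\<^sub>m (t + 0) = 0\<^sub>m n n"
    by (rule shift_equiv_nilpotent[OF _ _ _ assms(2)]) (auto intro: eq_matI)
  with that show thesis by blast
qed

text \<open>Uniqueness of the core: shrinking preserves the shift equivalence class, and on
  invertible matrices shift equivalence is similarity.\<close>

lemma similar_of_shift_equiv_shrinks:
  fixes A B :: "'d :: division_ring mat"
  assumes "shift_equiv t A B" "shrinks r A U" "invertible_mat U" "shrinks s B V" "invertible_mat V"
  shows "similar_mat U V"
proof -
  from shift_equiv_of_shrinks[OF assms(2)] obtain a where "shift_equiv a A U" .
  moreover from shift_equiv_of_shrinks[OF assms(4)] obtain b where "shift_equiv b B V" .
  ultimately have "shift_equiv (a + t + b) U V"
    using assms(1) shift_equiv_trans shift_equiv_sym by blast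
  from similar_of_shift_equiv_invertible[OF this assms(3,5)] show ?thesis .
qed

lemma invertible_dsum:
  assumes "invertible_mat A" "A \<in> carrier_mat n n" "invertible_mat B" "B \<in> carrier_mat m m"
  shows "invertible_mat (dsum A B)"
proof -
  from invertible_matE[OF assms(1,2)] obtain A' where A': "A' \<in> carrier_mat n n" "A * A' = 1\<^sub>m n" "A' * A = 1\<^sub>m n" .
  from invertible_matE[OF assms(3,4)] obtain B' where B': "B' \<in> carrier_mat m m" "B * B' = 1\<^sub>m m" "B' * B = 1\<^sub>m m" .
  show ?thesis
    by (rule invertible_matI[of _ "n + m" "dsum A' B'"]) (use A' B' assms in \<open>auto simp: dsum_mult dsum_one\<close>)
qed

text \<open>For a square matrix \<open>B\<close>, shrinking to the empty matrix \<open>1\<^sub>m 0\<close> says that \<open>B\<close> is nilpotent.\<close>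

lemma shrinks_empty_of_summand:
  fixes A :: "'d :: division_ring mat"
  assumes A: "similar_mat A (dsum M B)" and M: "M \<in> carrier_mat p p" and B: "B \<in> carrier_mat k k"
    and C: "shrinks s M C" "invertible_mat C" "C \<in> carrier_mat c c"
    and V: "shrinks t A V" "invertible_mat V" "V \<in> carrier_mat c c"
  shows "shrinks k B (1\<^sub>m 0)"
proof -
  from exists_shrinks_invertible[OF B] obtain r W where W: "shrinks r B W" "invertible_mat W" .
  from shrinks_carrierE[OF W(1)] obtain w where w: "W \<in> carrier_mat w w" "B \<in> carrier_mat (r + w) (r + w)" .
  \<comment> \<open>Shrinking both summands makes \<open>dsum C W\<close> an invertible core of
    \<open>A\<close>. It is similar to \<open>V\<close>, and comparing sizes leaves no room for
    \<open>W\<close>.\<close>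
  from A shrinks_trans[OF shrinks_dsum'[OF W(1) M] shrinks_dsum[OF C(1) w(1)]]
  have 1: "shrinks (r + s) A (dsum C W)" by (rule similar_shrinks)
  from similar_matD[OF A] obtain n where "A \<in> carrier_mat n n" by blast
  from similar_of_shift_equiv_shrinks[OF shift_equiv_refl[OF this] 1 invertible_dsum[OF C(2,3) W(2) w(1)] V(1,2)]
  have "similar_mat (dsum C W) V" .
  from similar_mat_carrier[OF this dsum_carrier[OF C(3) w(1)]] V(3) have "w = 0" by auto
  with w B have "r = k" "W = 1\<^sub>m 0" by (auto intro: one_mat_0_eq)
  with W show ?thesis by simp
qed

text \<open>\<open>S * R\<close> is a power of \<open>U\<close>; multiplying \<open>R\<close> by the
  inverse \<open>W\<close> of that power turns \<open>R * W\<close> and \<open>S\<close> into a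
  retract intertwining \<open>A\<close> with \<open>U\<close>. The complement is nilpotent because
  \<open>U\<close> already exhausts the core.\<close>

lemma fitting_decomposition:
  fixes A :: "'d :: division_ring mat"
  assumes "shrinks r A U" "invertible_mat U"
  obtains B where "similar_mat A (dsum U B)" "B \<in> carrier_mat r r" "shrinks r B (1\<^sub>m 0)"
proof -
  from shrinks_carrierE[OF assms(1)] obtain k where U: "U \<in> carrier_mat k k" and A: "A \<in> carrier_mat (r + k) (r + k)" .
  from shift_equiv_of_shrinks[OF assms(1)] obtain t where t: "shift_equiv t A U" .
  from shift_equivE[OF t A U] obtain R S where 1: "R \<in> carrier_mat (r + k) k" "S \<in> carrier_mat k (r + k)"
    "A * R = R * U" "S * A = U * S" "S * R = U ^\<^sub>m t" by metis
  from invertible_matE[OF invertible_pow_mat[OF assms(2) U] pow_mat_carrier[OF U]]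
  obtain W where W: "W \<in> carrier_mat k k" "U ^\<^sub>m t * W = 1\<^sub>m k" "W * U ^\<^sub>m t = 1\<^sub>m k" .
  \<comment> \<open>The inverse of a power of \<open>U\<close> commutes with \<open>U\<close>; this
    keeps \<open>R * W\<close> an intertwiner.\<close>
  have "U * W = (W * U ^\<^sub>m t) * (U * W)" unfolding W(3) using U W(1) by simp
  also have "\<dots> = W * ((U ^\<^sub>m t * U) * W)" using U W(1) by (simp add: assoc_mult_mat_dim)
  also have "\<dots> = W * ((U * U ^\<^sub>m t) * W)" unfolding pow_mat_intertwine[OF U U U refl] ..
  also have "\<dots> = W * U * (U ^\<^sub>m t * W)" using U W(1) by (simp add: assoc_mult_mat_dim)
  also have "\<dots> = W * U" unfolding W(2) using U W(1) by simp
  finally have UW: "U * W = W * U" .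
  have "S * (R * W) = (S * R) * W" using 1(1,2) W(1) by (simp add: assoc_mult_mat_dim)
  then have QP: "S * (R * W) = 1\<^sub>m k" unfolding 1(5) W(2) .
  have "A * (R * W) = (A * R) * W" using A 1(1) W(1) by (simp add: assoc_mult_mat_dim)
  also have "\<dots> = R * (U * W)" unfolding 1(3) using U 1(1) W(1) by (simp add: assoc_mult_mat_dim)
  also have "\<dots> = (R * W) * U" unfolding UW using U 1(1) W(1) by (simp add: assoc_mult_mat_dim)
  finally have AP: "A * (R * W) = (R * W) * U" .
  from similar_dsum_of_retract[OF A U U _ 1(2) QP AP 1(4)] 1(1) W(1) obtain l B where
    B: "k + l = r + k" "B \<in> carrier_mat l l" "similar_mat A (dsum U B)" by auto
  have "shrinks l B (1\<^sub>m 0)"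
    by (rule shrinks_empty_of_summand[OF B(3) U B(2) _ assms(2) U assms U, of 0]) (simp add: similar_mat_refl[OF U])
  with B that show thesis by auto
qed

text \<open>
  With an entry \<open>(i\<^sub>0, j\<^sub>0)\<close> at which \<open>A\<^sup>p\<close> does not vanish, the block is spanned by the columns
  \<open>A\<^sup>l e\<close> with \<open>e\<close> the basis vector \<open>j\<^sub>0\<close>; the rows \<open>i\<^sub>0\<close> of the powers of \<open>A\<close> give the dual functionals, up to an
  invertible triangular matrix.
\<close>

lemma jordan_block_decomposition:
  fixes A :: "'d :: division_ring mat"
  assumes A: "A \<in> carrier_mat n n" and q: "A ^\<^sub>m Suc p = 0\<^sub>m n n" "A ^\<^sub>m p \<noteq> 0\<^sub>m n n"
  obtains k B where "Suc p + k = n" "B \<in> carrier_mat k k" "similar_mat A (dsum (shift_mat (Suc p)) B)"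
    "shrinks k B (1\<^sub>m 0)"
proof -
  let ?q = "Suc p"
  have "A ^\<^sub>m p = 0\<^sub>m n n" if "\<And>i j. i < n \<Longrightarrow> j < n \<Longrightarrow> (A ^\<^sub>m p) $$ (i, j) = 0"
    using that A by (intro eq_matI) auto
  with q(2) obtain i0 j0 where ij: "i0 < n" "j0 < n" "(A ^\<^sub>m p) $$ (i0, j0) \<noteq> 0" by blast
  have Az: "A ^\<^sub>m s = 0\<^sub>m n n" if "s > p" for s
  proof -
    have "A ^\<^sub>m s = A ^\<^sub>m Suc p * A ^\<^sub>m (s - Suc p)"
      using pow_mat_add[OF A, of "Suc p" "s - Suc p"] that by simp
    then show ?thesis unfolding q(1) using A by simp
  qed
  \<comment> \<open>The exponents fall along the columns of \<open>P\<close> and rise along the rows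
    of \<open>Q0\<close>, so that multiplication by \<open>A\<close> acts as the shift on both; at
    the end of each sequence \<open>A ^\<^sub>m Suc p = 0\<close> supplies the zero.\<close>
  define P where "P = mat n ?q (\<lambda>(i, l). (A ^\<^sub>m (p - l)) $$ (i, j0))"
  define Q0 where "Q0 = mat ?q n (\<lambda>(l, j). (A ^\<^sub>m l) $$ (i0, j))"
  have P: "P \<in> carrier_mat n ?q" and Q0: "Q0 \<in> carrier_mat ?q n" unfolding P_def Q0_def by auto
  have Pi: "P $$ (i, l) = (A ^\<^sub>m (p - l)) $$ (i, j0)" if "i < n" "l < ?q" for i l
    using that by (simp add: P_def)
  have Qi: "Q0 $$ (l, j) = (A ^\<^sub>m l) $$ (i0, j)" if "l < ?q" "j < n" for l j
    using that by (simp add: Q0_def)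
  have AM: "(M * P) $$ (i, l) = (M * A ^\<^sub>m (p - l)) $$ (i, j0)" if "i < m" "l < ?q" "M \<in> carrier_mat m n" for M m i l
    using that P A ij(2)
    by (simp add: index_mult_mat_sum[OF that(3) P] index_mult_mat_sum[OF that(3) pow_mat_carrier[OF A]]
      Pi del: index_mult_mat(1))
  have MQ: "(Q0 * M) $$ (l, j) = (A ^\<^sub>m l * M) $$ (i0, j)" if "l < ?q" "j < m" "M \<in> carrier_mat n m" for M m l j
    using that Q0 A ij(1)
    by (simp add: index_mult_mat_sum[OF Q0 that(3)] index_mult_mat_sum[OF pow_mat_carrier[OF A] that(3)]
      Qi del: index_mult_mat(1))
  let ?S = "shift_mat ?q :: 'd mat"
  have AP: "A * P = P * ?S"
  proof (rule eq_matI)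
    fix i l assume "i < dim_row (P * ?S)" "l < dim_col (P * ?S)"
    then have il: "i < n" "l < ?q" using P by (auto simp: shift_mat_def)
    have "(A * P) $$ (i, l) = (A ^\<^sub>m (Suc (p - l))) $$ (i, j0)"
      unfolding AM[OF il A] using pow_mat_add[OF A, of 1 "p - l"] A by simp
    moreover have "(P * ?S) $$ (i, l) = (\<Sum>m<?q. if Suc m = l then P $$ (i, m) else 0)"
      unfolding index_mult_mat_sum[OF P shift_mat_carrier il]
      by (rule sum.cong) (use il in \<open>auto simp: shift_mat_def\<close>)
    moreover have "\<dots> = (if l = 0 then 0 else P $$ (i, l - 1))"
    proof (cases l)
      case (Suc l')
      have "(\<Sum>m<?q. if Suc m = l then P $$ (i, m) else 0) = (\<Sum>m<?q. if m = l' then P $$ (i, m) else 0)"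
        using Suc by (intro sum.cong) auto
      then show ?thesis using Suc il by (simp add: sum.delta del: sum.lessThan_Suc)
    qed simp
    ultimately show "(A * P) $$ (i, l) = (P * ?S) $$ (i, l)"
      using il ij Az[of "Suc p"] by (cases l) (auto simp: Pi Suc_diff_Suc simp del: pow_mat.simps index_mult_mat(1))
  qed (use A P in \<open>auto simp: shift_mat_def\<close>)
  have QA: "Q0 * A = ?S * Q0"
  proof (rule eq_matI)
    fix l j assume "l < dim_row (?S * Q0)" "j < dim_col (?S * Q0)"
    then have lj: "l < ?q" "j < n" using Q0 by (auto simp: shift_mat_def)
    have "(Q0 * A) $$ (l, j) = (A ^\<^sub>m (Suc l)) $$ (i0, j)"
      unfolding MQ[OF lj A] by simp
    moreover have "(?S * Q0) $$ (l, j) = (\<Sum>m<?q. if m = Suc l then Q0 $$ (m, j) else 0)"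
      unfolding index_mult_mat_sum[OF shift_mat_carrier Q0 lj]
      by (rule sum.cong) (use lj in \<open>auto simp: shift_mat_def\<close>)
    moreover have "\<dots> = (if Suc l < ?q then Q0 $$ (Suc l, j) else 0)"
      by (simp add: sum.delta del: sum.lessThan_Suc)
    ultimately show "(Q0 * A) $$ (l, j) = (?S * Q0) $$ (l, j)"
      using lj ij Az[of "Suc l"] by (auto simp: Qi simp del: pow_mat.simps index_mult_mat(1))
  qed (use A Q0 in \<open>auto simp: shift_mat_def\<close>)
  let ?G = "Q0 * P"
  have G: "?G \<in> carrier_mat ?q ?q" using Q0 P by auto
  have Gi: "?G $$ (l, m) = (A ^\<^sub>m (l + (p - m))) $$ (i0, j0)" if "l < ?q" "m < ?q" for l m
    unfolding AM[OF that Q0] using MQ[OF that(1) ij(2) pow_mat_carrier[OF A]] pow_mat_add[OF A] by simp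
  \<comment> \<open>Below the diagonal the entries of \<open>?G\<close> come from powers beyond
    \<open>p\<close> and vanish; on the diagonal stands the chosen nonzero entry. A left null vector
    therefore vanishes coordinate by coordinate.\<close>
  have "invertible_mat ?G"
  proof (rule invertible_if_no_left_null[OF G])
    fix x assume x: "x \<in> carrier_mat 1 ?q" "x * ?G = 0\<^sub>m 1 ?q"
    have "x $$ (0, m) = 0" if "m < ?q" for m using that
    proof (induction m rule: less_induct)
      case (less m)
      have "0 = (x * ?G) $$ (0, m)" unfolding x(2) using less.prems by simp
      also have "\<dots> = (\<Sum>l<?q. x $$ (0, l) * ?G $$ (l, m))"
        using less.prems by (subst index_mult_mat_sum[OF x(1) G]) auto
      also have "\<dots> = (\<Sum>l<?q. if l = m then x $$ (0, m) * (A ^\<^sub>m p) $$ (i0, j0) else 0)"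
      proof (rule sum.cong[OF refl])
        fix l assume l: "l \<in> {..<?q}"
        consider "l < m" | "l = m" | "l > m" by linarith
        then show "x $$ (0, l) * ?G $$ (l, m) = (if l = m then x $$ (0, m) * (A ^\<^sub>m p) $$ (i0, j0) else 0)"
        proof cases
          case 1
          with less l show ?thesis by (simp del: index_mult_mat(1))
        next
          case 2
          with less l show ?thesis by (simp add: Gi del: index_mult_mat(1))
        next
          case 3
          then have "l + (p - m) > p" using less.prems by linarith
          with Az[OF this] less l 3 ij show ?thesis by (simp add: Gi del: index_mult_mat(1))
        qed
      qed
      also have "\<dots> = x $$ (0, m) * (A ^\<^sub>m p) $$ (i0, j0)" using less.prems by (simp add: sum.delta del: sum.lessThan_Suc)
      finally show ?case using ij(3) by simp
    qed
    then show "x = 0\<^sub>m 1 ?q" using x(1) by (intro eq_matI) auto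
  qed
  from invertible_matE[OF this G] obtain H where H: "H \<in> carrier_mat ?q ?q" "?G * H = 1\<^sub>m ?q" "H * ?G = 1\<^sub>m ?q" .
  \<comment> \<open>Normalizing \<open>Q0\<close> by the inverse \<open>H\<close> of
    \<open>?G\<close> yields a retract, at the price of conjugating the shift on the row
    side.\<close>
  let ?S' = "H * ?S * ?G"
  have Q: "H * Q0 \<in> carrier_mat ?q n" using H Q0 by auto
  have S': "?S' \<in> carrier_mat ?q ?q" using H(1) G by (meson mult_carrier_mat shift_mat_carrier)
  have QP: "(H * Q0) * P = 1\<^sub>m ?q" using H Q0 P by (simp add: assoc_mult_mat_dim)
  have "(H * Q0) * A = H * (?S * Q0)" using H(1) Q0 A by (simp add: QA assoc_mult_mat_dim)
  also have "\<dots> = H * ?S * ((?G * H) * Q0)" unfolding H(2) using H(1) Q0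
    by (simp add: assoc_mult_mat_dim)
  also have "\<dots> = ?S' * (H * Q0)" using H(1) P Q0
    by (simp add: assoc_mult_mat_dim)
  finally have QA': "(H * Q0) * A = ?S' * (H * Q0)" .
  from similar_dsum_of_retract[OF A shift_mat_carrier S' P Q QP AP QA'] obtain k B where
    B: "?q + k = n" "B \<in> carrier_mat k k" "similar_mat A (dsum ?S B)" .
  have "shrinks k B (1\<^sub>m 0)"
  proof (rule shrinks_empty_of_summand[OF B(3) shift_mat_carrier B(2) _ invertible_one_mat one_carrier_mat _ invertible_one_mat one_carrier_mat])
    show "shrinks n A (1\<^sub>m 0)" by (rule shrinks_empty_of_nilpotent[OF A q(1)])
    have "shift_mat 0 = (1\<^sub>m 0 :: 'd mat)" by (rule one_mat_0_eq) simp
    then show "shrinks ?q ?S (1\<^sub>m 0)" using shrinks_shift_mat[of ?q 0, where 'a = 'd] by simp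
  qed
  with B that show thesis by blast
qed


section \<open>The diameter\<close>

text \<open>The chain starts at \<open>A\<close> with an empty second summand and ends at
  \<open>dsum C D\<close>.\<close>

lemma sim_n_of_shrinks:
  fixes A :: "'a :: semiring_1 mat"
  assumes A: "A \<in> carrier_mat n n" and "shrinks r A C" "shrinks r D (1\<^sub>m 0)" "similar_mat B (dsum C D)"
  shows "sim_n (ring_mat TYPE('a) n b) (max 1 r) A B"
proof -
  from chain_of_shrinks[OF assms(2,3)] have "chain r A (dsum C D)" by simp
  from sim_n_of_chain[OF chain_similar[OF this similar_mat_sym[OF assms(4)]] A] show ?thesis .
qed

text \<open>
  The block of \<open>A\<close> is at least as large as that of \<open>B\<close>, so \<open>A\<close> shrinks to the block of \<open>B\<close>; keeping this
  nonempty block in common is what saves the last step and gives \<open>n - 1\<close> instead of \<open>n\<close>.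
\<close>

lemma sim_n_nilpotent_le:
  fixes A B :: "'d :: division_ring mat"
  assumes A: "A \<in> carrier_mat n n" "A ^\<^sub>m Suc p = 0\<^sub>m n n" "A ^\<^sub>m p \<noteq> 0\<^sub>m n n"
    and B: "B \<in> carrier_mat n n" "B ^\<^sub>m Suc q = 0\<^sub>m n n" "B ^\<^sub>m q \<noteq> 0\<^sub>m n n"
    and "q \<le> p"
  shows "\<exists>r\<le>max 1 (n - 1). sim_n (ring_mat TYPE('d) n b) r A B"
proof -
  from jordan_block_decomposition[OF A] obtain k E where
    E: "Suc p + k = n" "E \<in> carrier_mat k k" "similar_mat A (dsum (shift_mat (Suc p)) E)" "shrinks k E (1\<^sub>m 0)" .
  from jordan_block_decomposition[OF B] obtain l D where
    D: "Suc q + l = n" "D \<in> carrier_mat l l" "similar_mat B (dsum (shift_mat (Suc q)) D)" "shrinks l D (1\<^sub>m 0)" .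
  have "shrinks (p - q) (shift_mat (Suc p) :: 'd mat) (shift_mat (Suc q))"
    using shrinks_shift_mat[of "p - q" "Suc q", where 'a = 'd] \<open>q \<le> p\<close> by simp
  from shrinks_trans[OF shrinks_dsum[OF this E(2)] shrinks_dsum'[OF E(4) shift_mat_carrier]]
  have "shrinks (p - q + k) (dsum (shift_mat (Suc p)) E) (shift_mat (Suc q))" by simp
  \<comment> \<open>Removing everything but a block of size \<open>Suc q\<close> from
    \<open>A\<close> takes as many steps as building \<open>D\<close>; both counts are
    \<open>n - Suc q\<close>, at most \<open>n - 1\<close>.\<close>
  moreover have "p - q + k = l" using E(1) D(1) \<open>q \<le> p\<close> by linarith
  ultimately have "shrinks l A (shift_mat (Suc q))" using similar_shrinks[OF E(3)] by simp
  from sim_n_of_shrinks[OF A(1) this D(4,3), where b = b] show ?thesis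
    using D(1) by (intro exI[of _ "max 1 l"]) auto
qed

lemma nilpotency_indexE:
  fixes A :: "'a :: semiring_1 mat"
  assumes "A \<in> carrier_mat n n" "A ^\<^sub>m r = 0\<^sub>m n n" "n \<ge> 1"
  obtains p where "A ^\<^sub>m Suc p = 0\<^sub>m n n" "A ^\<^sub>m p \<noteq> 0\<^sub>m n n"
proof -
  \<comment> \<open>In positive size the zeroth power is nonzero, so the least vanishing exponent is
    a successor.\<close>
  have "A ^\<^sub>m 0 \<noteq> 0\<^sub>m n n"
  proof
    assume "A ^\<^sub>m 0 = 0\<^sub>m n n"
    from arg_cong[OF this, of "\<lambda>M. M $$ (0, 0)"] assms(1,3) show False by simp
  qed
  with ex_least_nat_less[of "\<lambda>r. A ^\<^sub>m r = 0\<^sub>m n n" r] assms(2) obtain p where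
    "\<forall>i\<le>p. A ^\<^sub>m i \<noteq> 0\<^sub>m n n" "A ^\<^sub>m Suc p = 0\<^sub>m n n" by metis
  with that show thesis by blast
qed

lemma sim_n_nilpotent:
  fixes A B :: "'d :: division_ring mat"
  assumes A: "A \<in> carrier_mat n n" "A ^\<^sub>m r = 0\<^sub>m n n"
    and B: "B \<in> carrier_mat n n" "B ^\<^sub>m s = 0\<^sub>m n n" and n: "n \<ge> 1"
  shows "\<exists>t\<le>max 1 (n - 1). sim_n (ring_mat TYPE('d) n b) t A B"
proof -
  from nilpotency_indexE[OF A n] obtain p where p: "A ^\<^sub>m Suc p = 0\<^sub>m n n" "A ^\<^sub>m p \<noteq> 0\<^sub>m n n" .
  from nilpotency_indexE[OF B n] obtain q where q: "B ^\<^sub>m Suc q = 0\<^sub>m n n" "B ^\<^sub>m q \<noteq> 0\<^sub>m n n" .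
  show ?thesis
  proof (cases "q \<le> p")
    case True
    then show ?thesis by (rule sim_n_nilpotent_le[OF A(1) p B(1) q])
  next
    case False
    then have "p \<le> q" by simp
    from sim_n_nilpotent_le[OF B(1) q A(1) p this, of b] obtain t where
      t: "t \<le> max 1 (n - 1)" "sim_n (ring_mat TYPE('d) n b) t B A" by blast
    have "B \<in> carrier (ring_mat TYPE('d) n b)" using B(1) by (simp add: ring_mat_simps)
    from t(1) sim_n_sym[OF this t(2)] show ?thesis by blast
  qed
qed

lemma sim_n_bound:
  fixes A B :: "'d :: division_ring mat"
  assumes A: "A \<in> carrier_mat n n" and B: "B \<in> carrier_mat n n" and n: "n \<ge> 1"
    and sim: "sim_n (ring_mat TYPE('d) n b) j A B"
  shows "\<exists>t\<le>max 1 (n - 1). sim_n (ring_mat TYPE('d) n b) t A B"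
proof -
  from exists_shrinks_invertible[OF A] obtain r U where U: "shrinks r A U" "invertible_mat U" .
  from exists_shrinks_invertible[OF B] obtain s V where V: "shrinks s B V" "invertible_mat V" .
  from shrinks_carrierE[OF U(1)] obtain k where k: "U \<in> carrier_mat k k" "A \<in> carrier_mat (r + k) (r + k)" .
  from shrinks_carrierE[OF V(1)] obtain l where l: "V \<in> carrier_mat l l" "B \<in> carrier_mat (s + l) (s + l)" .
  from similar_of_shift_equiv_shrinks[OF shift_equiv_of_sim_n[OF sim A] U V] have UV: "similar_mat U V" .
  from similar_mat_carrier[OF this k(1)] l(1) have "k = l" by auto
  from k(2) A have rk: "r + k = n" by auto
  from l(2) B \<open>k = l\<close> rk have "s = r" by auto
  show ?thesis
  \<comment> \<open>For an empty core \<open>r = n\<close>, so the route through the core would take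
    one step too many; the common nilpotent block replaces it.\<close>
  proof (cases "k = 0")
    case True
    then have "U = 1\<^sub>m 0" "V = 1\<^sub>m 0" "r = n" using k l \<open>k = l\<close> rk by (auto intro: one_mat_0_eq)
    with U(1) V(1) \<open>s = r\<close> have e: "shrinks n A (1\<^sub>m 0)" "shrinks n B (1\<^sub>m 0)" by auto
    from nilpotent_of_shrinks_empty[OF e(1) A] obtain a where a: "A ^\<^sub>m a = 0\<^sub>m n n" .
    from nilpotent_of_shrinks_empty[OF e(2) B] obtain c where "B ^\<^sub>m c = 0\<^sub>m n n" .
    from sim_n_nilpotent[OF A a B this n] show ?thesis .
  next
    case False
    from fitting_decomposition[OF V] obtain D where
      D: "similar_mat B (dsum V D)" "D \<in> carrier_mat s s" "shrinks s D (1\<^sub>m 0)" .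
    \<comment> \<open>The cores are similar, so \<open>A\<close> shrinks to the core of
      \<open>B\<close> itself, in \<open>n - k\<close> steps with \<open>k\<close> positive. For
      invertible \<open>A\<close> this count is 0 and the similarity costs one step.\<close>
    have "shrinks r A V" using shrinks_trans[OF U(1), of 0 V] UV by simp
    from sim_n_of_shrinks[OF A this _ D(1), of b] D(3) \<open>s = r\<close>
    have "sim_n (ring_mat TYPE('d) n b) (max 1 r) A B" by simp
    with False rk show ?thesis by (intro exI[of _ "max 1 r"]) auto
  qed
qed

lemma sim_n_mat_1_eq:
  fixes A B :: "'d :: division_ring mat"
  assumes "\<forall>x y :: 'd. x * y = y * x" and "sim_n (ring_mat TYPE('d) 1 b) r A B"
  shows "A = B"
  using assms(2)
proof (induction r arbitrary: A)
  case (Suc r)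
  then obtain C where C: "sim1 (ring_mat TYPE('d) 1 b) A C" "sim_n (ring_mat TYPE('d) 1 b) r C B" by auto
  from C(1) obtain X Y where XY: "X \<in> carrier_mat 1 1" "Y \<in> carrier_mat 1 1" "A = X * Y" "C = Y * X"
    unfolding sim1_def by (auto simp: ring_mat_simps)
  then have "A = C" using assms(1) by (intro eq_matI) (auto simp: scalar_prod_def)
  with Suc.IH[OF C(2)] show ?case by simp
qed simp

lemma comm_dist_le: "sim_n R r y x \<Longrightarrow> comm_dist R x y \<le> r"
  unfolding comm_dist_def by (rule Least_le)

theorem theorem3p9:
  fixes n :: nat
  assumes "n \<ge> 1"
    and "n = 1 \<longrightarrow> (\<forall>x y :: 'd :: division_ring. x * y = y * x)"
  shows "ring_diam (ring_mat TYPE('d) n ()) = enat (n - 1)"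
proof (rule antisym)
  let ?R = "ring_mat TYPE('d) n ()"
  have carr: "carrier ?R = carrier_mat n n" by (simp add: ring_mat_simps)
  have le: "comm_dist ?R x y \<le> n - 1" if xy: "x \<in> comm_closure ?R a" "y \<in> comm_closure ?R a" for a x y
  proof -
    from xy have c: "x \<in> carrier_mat n n" "y \<in> carrier_mat n n"
      unfolding comm_closure_def carr by auto
    from comm_closure_imp_sim[OF xy] obtain j where j: "sim_n ?R j y x" unfolding sim_def by blast
    show ?thesis
    \<comment> \<open>The general bound \<open>max 1 (n - 1)\<close> is too weak by one exactly for
      \<open>n = 1\<close>, where commutativity makes every step trivial.\<close>
    proof (cases "n = 1")
      case True
      with sim_n_mat_1_eq[of "()" j y x] assms(2) j have "sim_n ?R 0 y x" by simp
      from comm_dist_le[OF this] show ?thesis by simp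
    next
      case False
      from sim_n_bound[OF c(2,1) assms(1) j] obtain t where t: "t \<le> max 1 (n - 1)" "sim_n ?R t y x" by blast
      from t(1) comm_dist_le[OF t(2)] False assms(1) show ?thesis by simp
    qed
  qed
  show "ring_diam ?R \<le> enat (n - 1)"
    unfolding ring_diam_def closure_diam_def by (intro SUP_least) (use le in auto)
  \<comment> \<open>Both matrices are nilpotent, so the upper bound already places them in one
    closure.\<close>
  let ?Z = "0\<^sub>m n n :: 'd mat" and ?S = "shift_mat n :: 'd mat"
  have S: "?S \<in> carrier_mat n n" and Z: "?Z \<in> carrier_mat n n" by simp_all
  have S0: "?S ^\<^sub>m n = 0\<^sub>m n n" unfolding shift_mat_pow by (intro eq_matI) auto
  have Z1: "?Z ^\<^sub>m 1 = 0\<^sub>m n n" by simp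
  from sim_n_nilpotent[OF Z Z1 S S0 assms(1), of "()"] obtain t where t: "sim_n ?R t ?Z ?S" by blast
  have mem: "?S \<in> comm_closure ?R ?S" "?Z \<in> comm_closure ?R ?S"
    unfolding comm_closure_def sim_def carr using t S Z sim_n.simps(1)[of ?R ?S ?S] by blast+
  have "sim_n ?R (comm_dist ?R ?S ?Z) ?Z ?S" unfolding comm_dist_def by (rule LeastI[of "\<lambda>k. sim_n ?R k ?Z ?S", OF t])
  \<comment> \<open>The lag is the distance, and the zero matrix contributes exponent 1.\<close>
  from shift_equiv_nilpotent[OF shift_equiv_of_sim_n[OF this Z] Z Z1 S]
  have pow: "?S ^\<^sub>m (comm_dist ?R ?S ?Z + 1) = 0\<^sub>m n n" .
  have "n \<le> comm_dist ?R ?S ?Z + 1"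
  proof (rule ccontr)
    assume "\<not> n \<le> comm_dist ?R ?S ?Z + 1"
    \<comment> \<open>An exponent below \<open>n\<close> leaves a 1 in the first row of the power of
      the shift.\<close>
    with arg_cong[OF pow, of "\<lambda>M. M $$ (0, comm_dist ?R ?S ?Z + 1)"] show False
      unfolding shift_mat_pow by simp
  qed
  then have "enat (n - 1) \<le> enat (comm_dist ?R ?S ?Z)" by simp
  also have "\<dots> \<le> closure_diam ?R ?S"
    unfolding closure_diam_def by (rule SUP_upper2[of "(?S, ?Z)"]) (use mem in auto)
  also have "\<dots> \<le> ring_diam ?R"
    unfolding ring_diam_def by (rule SUP_upper) (simp add: carr)
  finally show "enat (n - 1) \<le> ring_diam ?R" .
qed

end
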